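(* Let $q:\mathbb{R}\to\mathbb{R}$ be a non-negative function with $q\in L^{1}(\mathbb{R})$. Let $\lambda_0<\lambda_1\le\lambda_2\le\cdots$ denote the eigenvalues (counted with multiplicity) of the Schr\"odinger operator $-\frac{d^2}{dx^2}+x^2+q(x)$ on $L^2(\mathbb{R})$, i.e. of the problem $-u''(x)+[x^2+q(x)]u(x)=\lambda u(x)$, $x\in\mathbb{R}$, and let $\lambda_k^0=2k+1$, $k=0,1,2,\dots$, be the eigenvalues of the harmonic oscillator $-u''+x^2u=\lambda u$ on $\mathbb{R}$. Then for every $n=0,1,2,\dots$, \[ \sum_{k=0}^{n}\left[\lambda_k-\lambda_k^0-\frac{1}{\pi\sqrt{\lambda_k^0}}\int_{\mathbb{R}}q(x)\,dx\right]\le \frac{\chi_n}{\pi}\int_{\mathbb{R}}q(x)\,dx, \] where \[ \chi_n=\begin{cases}\dfrac{2n+3}{n+1}\,\dfrac{\Gamma\left(\frac n2+1\right)}{\Gamma\left(\frac{n+1}{2}\right)}-\displaystyle\sum_{k=0}^n\frac{1}{\sqrt{\lambda_k^0}}, & n\text{ odd},\\[3ex] (n+1)\dfrac{\Gamma\left(\frac{n+1}{2}\right)}{\Gamma\left(\frac n2+1\right)}-\displaystyle\sum_{k=0}^n\frac{1}{\sqrt{\lambda_k^0}}, & n\text{ even}.\end{cases} \] Furthermore, $\chi_n=-Z_0(1/2)+O(1/\sqrt n)$ as $n\to\infty$, where $Z_0(s)=(1-2^{-s})\zeta(s)$ and $\zeta$ is the Riemann zeta function.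
   Context: The operator $-\frac{d^2}{dx^2}+x^2+q$ with $q\in L^1(\mathbb{R})$ has purely discrete spectrum, so its eigenvalues form a sequence tending to $+\infty$. $\Gamma$ denotes the Gamma function. *)

theory Defs
  imports "HOL-Analysis.Analysis" "HOL-Library.Landau_Symbols"
begin

text \<open>Solutions of -u'' + (x^2 + q x) u = mu u on the real line lying in L^2(R),
  i.e. elements of the eigenspace of the (limit-point, hence maximal) Sturm--Liouville
  operator -d^2/dx^2 + x^2 + q on L^2(R) for the spectral parameter mu.
  u is C^1 with derivative u', u' is locally absolutely continuous and
  u'' = (x^2 + q - mu) u almost everywhere (written in integrated form).\<close>
definition L2_solution :: "(real \<Rightarrow> real) \<Rightarrow> real \<Rightarrow> (real \<Rightarrow> real) \<Rightarrow> bool" where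
  "L2_solution q mu u \<longleftrightarrow>
     u \<in> borel_measurable lborel \<and>
     integrable lborel (\<lambda>x. (u x)^2) \<and>
     (\<exists>u'. (\<forall>x. (u has_real_derivative u' x) (at x)) \<and>
           (\<forall>a b. a \<le> b \<longrightarrow>
              (\<lambda>x. (x^2 + q x - mu) * u x) absolutely_integrable_on {a..b} \<and>
              ((\<lambda>x. (x^2 + q x - mu) * u x) has_integral (u' b - u' a)) {a..b}))"

definition is_eigenvalue :: "(real \<Rightarrow> real) \<Rightarrow> real \<Rightarrow> bool" where
  "is_eigenvalue q mu \<longleftrightarrow> (\<exists>u. L2_solution q mu u \<and> u \<noteq> (\<lambda>x. 0))"

definition has_indep_eigenfunctions :: "(real \<Rightarrow> real) \<Rightarrow> real \<Rightarrow> nat \<Rightarrow> bool" where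
  "has_indep_eigenfunctions q mu n \<longleftrightarrow>
     (\<exists>us :: nat \<Rightarrow> real \<Rightarrow> real.
        (\<forall>i<n. L2_solution q mu (us i)) \<and>
        (\<forall>c :: nat \<Rightarrow> real. (\<forall>x. (\<Sum>i<n. c i * us i x) = 0) \<longrightarrow> (\<forall>i<n. c i = 0)))"

definition eigenvalue_sequence :: "(real \<Rightarrow> real) \<Rightarrow> (nat \<Rightarrow> real) \<Rightarrow> bool" where
  "eigenvalue_sequence q lam \<longleftrightarrow>
     mono lam \<and>
     (\<forall>mu. finite {k. lam k = mu} \<and>
           (\<forall>n. n \<le> card {k. lam k = mu} \<longleftrightarrow> has_indep_eigenfunctions q mu n))"

definition lam0 :: "nat \<Rightarrow> real" where
  "lam0 k = 2 * real k + 1"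

definition chi :: "nat \<Rightarrow> real" where
  "chi n = (if odd n
     then (2 * real n + 3) / (real n + 1) * Gamma (real n / 2 + 1) / Gamma ((real n + 1) / 2)
          - (\<Sum>k\<le>n. 1 / sqrt (lam0 k))
     else (real n + 1) * Gamma ((real n + 1) / 2) / Gamma (real n / 2 + 1)
          - (\<Sum>k\<le>n. 1 / sqrt (lam0 k)))"

text \<open>Riemann zeta on 0 < s, s \<noteq> 1, via the Dirichlet eta function
  (the standard analytic continuation): zeta s = eta s / (1 - 2 powr (1 - s)).\<close>
definition dirichlet_eta :: "real \<Rightarrow> real" where
  "dirichlet_eta s = (\<Sum>n. (-1) ^ n / (real n + 1) powr s)"

definition riemann_zeta :: "real \<Rightarrow> real" where
  "riemann_zeta s = dirichlet_eta s / (1 - 2 powr (1 - s))"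

definition Z0 :: "real \<Rightarrow> real" where
  "Z0 s = (1 - 2 powr (- s)) * riemann_zeta s"

end

theory Submission
  imports Defs "HOL-Real_Asymp.Real_Asymp" "HOL-Probability.Probability"
    "HOL-Complex_Analysis.Great_Picard"
begin

text \<open>
  Trial functions: the first n + 1 Hermite functions have total energy
  \<open>\<Sum>k\<le>n. 2k + 1\<close> plus the integral of q against their density \<open>S\<^sub>n = \<Sum>k\<le>n. \<psi>\<^sub>k\<^sup>2\<close>.
  The recurrences give \<open>(S\<^sub>n + S\<^sub>n\<^sub>+\<^sub>1)' = - 2 x \<psi>\<^sub>n\<^sub>+\<^sub>1\<^sup>2\<close>, so \<open>S\<^sub>n + S\<^sub>n\<^sub>+\<^sub>1\<close> is largest at 0. Hence
  \<open>S\<^sub>n\<close> is at most \<open>(S\<^sub>n(0) + S\<^sub>n\<^sub>+\<^sub>1(0)) / 2\<close>, whose value times \<open>\<pi>\<close> is the Gamma quotient in \<open>\<chi>\<^sub>n\<close>.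

  The variational principle is proved without spectral theory, by minimising the weighted energy
  \<open>\<Sum>k\<le>n. w\<^sub>k Q(f\<^sub>k)\<close> over orthonormal frames of the form domain. Since the weights are strictly
  decreasing, rotations inside the frame show that near-minimisers almost diagonalise Q, and tilts
  out of the frame show that each member almost solves the eigenvalue equation weakly. Hoelder
  bounds and the confining potential \<open>x\<^sup>2\<close> give pointwise limits that stay linearly independent.
  Testing against piecewise linear hat functions turns the weak equation into an identity between
  difference quotients, from which the limits are seen to be \<open>L\<^sup>2\<close> solutions. Finally the weights
  tend to 1.

  For the asymptotics, \<open>\<Sum>k<m. 1 / sqrt (2k + 1)\<close> is expressed through the partial sums of
  \<open>\<Sum> k powr (-1/2)\<close> and of the alternating series.
\<close>

section \<open>Near-minimal frames for a pair of quadratic forms\<close>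

text \<open>The hypothesis on \<open>lam\<close> speaks only of multiplicities: how many independent
  solutions each parameter has. No min-max formula comes with it, so an upper bound for the sum of
  the first \<open>n + 1\<close> values requires exhibiting \<open>n + 1\<close> jointly independent
  solutions whose parameters have a small sum; these parameters are then placed injectively among
  the values of \<open>lam\<close>. The natural functional, the trace of Q over a frame, is
  invariant under rotations of the frame, so its minimisers need not diagonalise Q and single out no
  eigenfunctions. Unequal weights break this symmetry. The infimum is only approached, never
  attained, so every first-order condition carries an error tending to 0. Two dangers remain in the
  limit. Mass may escape to infinity, which would destroy independence; the bound on the integral of
  \<open>x\<^sup>2 * f\<^sup>2\<close> excludes this. And no convergence of derivatives is
  available, which is why the test functions have piecewise constant derivatives: paired with them,
  a derivative is seen only through point values of the function.\<close>

locale form_pair =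
  fixes D :: "'a set" and comb :: "real \<Rightarrow> 'a \<Rightarrow> real \<Rightarrow> 'a \<Rightarrow> 'a"
    and B Q :: "'a \<Rightarrow> 'a \<Rightarrow> real"
  assumes comb_closed: "\<lbrakk>f \<in> D; g \<in> D\<rbrakk> \<Longrightarrow> comb a f b g \<in> D"
    and B_comb_left: "\<lbrakk>f \<in> D; g \<in> D; h \<in> D\<rbrakk> \<Longrightarrow> B (comb a f b g) h = a * B f h + b * B g h"
    and Q_comb_left: "\<lbrakk>f \<in> D; g \<in> D; h \<in> D\<rbrakk> \<Longrightarrow> Q (comb a f b g) h = a * Q f h + b * Q g h"
    and B_sym: "\<lbrakk>f \<in> D; g \<in> D\<rbrakk> \<Longrightarrow> B f g = B g f"
    and Q_sym: "\<lbrakk>f \<in> D; g \<in> D\<rbrakk> \<Longrightarrow> Q f g = Q g f"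
    and B_nonneg: "f \<in> D \<Longrightarrow> 0 \<le> B f f"
    and Q_nonneg: "f \<in> D \<Longrightarrow> 0 \<le> Q f f"
begin

lemma B_comb_right: "\<lbrakk>f \<in> D; g \<in> D; h \<in> D\<rbrakk> \<Longrightarrow> B h (comb a f b g) = a * B h f + b * B h g"
  using B_comb_left[of f g h a b] B_sym comb_closed by metis

lemma Q_comb_right: "\<lbrakk>f \<in> D; g \<in> D; h \<in> D\<rbrakk> \<Longrightarrow> Q h (comb a f b g) = a * Q h f + b * Q h g"
  using Q_comb_left[of f g h a b] Q_sym comb_closed by metis

definition frame :: "nat \<Rightarrow> (nat \<Rightarrow> 'a) \<Rightarrow> bool" where
  "frame n F \<longleftrightarrow> (\<forall>i\<le>n. F i \<in> D) \<and> (\<forall>i\<le>n. \<forall>j\<le>n. B (F i) (F j) = (if i = j then 1 else 0))"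

definition energy :: "(nat \<Rightarrow> real) \<Rightarrow> nat \<Rightarrow> (nat \<Rightarrow> 'a) \<Rightarrow> real" where
  "energy w n F = (\<Sum>k\<le>n. w k * Q (F k) (F k))"

lemma frame_in: "frame n F \<Longrightarrow> i \<le> n \<Longrightarrow> F i \<in> D"
  by (simp add: frame_def)

lemma frame_B: "frame n F \<Longrightarrow> i \<le> n \<Longrightarrow> j \<le> n \<Longrightarrow> B (F i) (F j) = (if i = j then 1 else 0)"
  by (simp add: frame_def)

text \<open>A plane rotation preserves the sum of the two diagonal entries of Q, so the energy moves
  only by a multiple of \<open>w i - w j\<close>. The mixed term, linear in \<open>s\<close> for
  small angles, is what gives access to \<open>Q (F i) (F j)\<close>.\<close>

lemma frame_rotate:
  fixes c s :: real
  assumes F: "frame n F" and ij: "i \<le> n" "j \<le> n" "i \<noteq> j" and cs: "c^2 + s^2 = 1"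
  defines "G \<equiv> F(i := comb c (F i) s (F j), j := comb (- s) (F i) c (F j))"
  shows "frame n G"
    and "energy w n G = energy w n F +
      (w i - w j) * (s^2 * (Q (F j) (F j) - Q (F i) (F i)) + 2 * c * s * Q (F i) (F j))"
proof -
  have inD: "F k \<in> D" if "k \<le> n" for k using frame_in[OF F that] .
  have cc: "c * c + s * s = 1" using cs by (simp add: power2_eq_square)
  show "frame n G"
    unfolding frame_def G_def using ij cc
    by (auto simp: comb_closed inD B_comb_left B_comb_right frame_B[OF F] algebra_simps)
  have split: "(\<Sum>k\<le>n. f k) = f i + (f j + (\<Sum>k\<in>{..n} - {i} - {j}. f k))" for f :: "nat \<Rightarrow> real"
    using ij by (subst sum.remove[of _ i]; simp) (subst sum.remove[of _ j]; simp)
  have rest: "(\<Sum>k\<in>{..n} - {i} - {j}. w k * Q (G k) (G k)) = (\<Sum>k\<in>{..n} - {i} - {j}. w k * Q (F k) (F k))"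
    by (intro sum.cong) (auto simp: G_def)
  have c2: "c * c = 1 - s * s" using cc by simp
  have Gi: "Q (G i) (G i) = c * c * Q (F i) (F i) + 2 * c * s * Q (F i) (F j) + s * s * Q (F j) (F j)"
    using ij by (simp add: G_def comb_closed inD Q_comb_left Q_comb_right Q_sym[of "F j" "F i"] algebra_simps)
  have Gj: "Q (G j) (G j) = s * s * Q (F i) (F i) - 2 * c * s * Q (F i) (F j) + c * c * Q (F j) (F j)"
    using ij by (simp add: G_def comb_closed inD Q_comb_left Q_comb_right Q_sym[of "F j" "F i"] algebra_simps)
  show "energy w n G = energy w n F +
      (w i - w j) * (s^2 * (Q (F j) (F j) - Q (F i) (F i)) + 2 * c * s * Q (F i) (F j))"
    unfolding energy_def split rest Gi Gj c2 power2_eq_square by (simp add: algebra_simps)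
qed

text \<open>Since \<open>h\<close> is orthogonal to the frame, \<open>F k + t h\<close> has squared
  norm \<open>r\<^sup>2\<close>, which explains the normalisation. The new diagonal entry is a
  Rayleigh quotient with derivative \<open>2 * Q (F k) h\<close> at \<open>t = 0\<close>.\<close>

lemma frame_tilt:
  fixes t :: real
  assumes F: "frame n F" and k: "k \<le> n" and h: "h \<in> D" and orth: "\<And>j. j \<le> n \<Longrightarrow> B h (F j) = 0"
  defines "r \<equiv> sqrt (1 + t^2 * B h h)"
  defines "G \<equiv> F(k := comb (1 / r) (F k) (t / r) h)"
  shows "frame n G"
    and "energy w n G = energy w n F + w k *
      ((Q (F k) (F k) + 2 * t * Q (F k) h + t^2 * Q h h) / (1 + t^2 * B h h) - Q (F k) (F k))"
proof -
  have inD: "F k \<in> D" if "k \<le> n" for k using frame_in[OF F that] .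
  have pos: "1 + t^2 * B h h > 0" using B_nonneg[OF h] by (simp add: add_pos_nonneg)
  have r2: "r * r = 1 + t^2 * B h h" and r0: "r > 0" using pos by (auto simp: r_def)
  have orth': "B (F j) h = 0" if "j \<le> n" for j using orth[OF that] B_sym[OF h inD[OF that]] by simp
  have "B (G k) (G k) = (1 + t^2 * B h h) / (r * r)"
    using k h orth[OF k] orth'[OF k] r0
    by (simp add: G_def comb_closed inD B_comb_left B_comb_right frame_B[OF F] power2_eq_square add_divide_distrib)
  then have 1: "B (G k) (G k) = 1" using r2 pos by simp
  show "frame n G"
    unfolding frame_def
    using 1 k h by (auto simp: G_def comb_closed inD B_comb_left B_comb_right frame_B[OF F] orth orth')
  have Gk: "Q (G k) (G k) = (Q (F k) (F k) + 2 * t * Q (F k) h + t^2 * Q h h) / (r * r)"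
    using k h r0 Q_sym[OF h inD[OF k]]
    by (simp add: G_def comb_closed inD Q_comb_left Q_comb_right power2_eq_square field_simps)
  have split: "(\<Sum>k\<le>n. f k) = f k + (\<Sum>k\<in>{..n} - {k}. f k)" for f :: "nat \<Rightarrow> real"
    using k by (subst sum.remove[of _ k]; simp)
  have rest: "(\<Sum>i\<in>{..n} - {k}. w i * Q (G i) (G i)) = (\<Sum>i\<in>{..n} - {k}. w i * Q (F i) (F i))"
    by (intro sum.cong) (auto simp: G_def)
  show "energy w n G = energy w n F + w k *
      ((Q (F k) (F k) + 2 * t * Q (F k) h + t^2 * Q h h) / (1 + t^2 * B h h) - Q (F k) (F k))"
    unfolding energy_def split rest Gk r2 by (simp add: algebra_simps)
qed

text \<open>Here \<open>h\<close> is \<open>g\<close> minus its projection onto the span of the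
  frame. The locale has no sums of elements and no equations between them, so \<open>h\<close> is
  built by iterating \<open>comb\<close> and known only through its pairings.\<close>

lemma frame_residual:
  assumes F: "frame n F" and g: "g \<in> D"
  obtains h where "h \<in> D"
    and "\<And>x. x \<in> D \<Longrightarrow> B h x = B g x - (\<Sum>j\<le>n. B (F j) g * B (F j) x)"
    and "\<And>x. x \<in> D \<Longrightarrow> Q h x = Q g x - (\<Sum>j\<le>n. B (F j) g * Q (F j) x)"
proof -
  have "\<exists>h\<in>D. (\<forall>x\<in>D. B h x = B g x - (\<Sum>j<N. B (F j) g * B (F j) x)) \<and>
      (\<forall>x\<in>D. Q h x = Q g x - (\<Sum>j<N. B (F j) g * Q (F j) x))" if "N \<le> Suc n" for N
    using that
  proof (induction N)
    case 0
    then show ?case using g by auto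
  next
    case (Suc N)
    then obtain h where h: "h \<in> D" "\<forall>x\<in>D. B h x = B g x - (\<Sum>j<N. B (F j) g * B (F j) x)"
      "\<forall>x\<in>D. Q h x = Q g x - (\<Sum>j<N. B (F j) g * Q (F j) x)" by auto
    have N: "F N \<in> D" using Suc.prems F by (auto intro: frame_in)
    show ?case
      by (rule bexI[of _ "comb 1 h (- B (F N) g) (F N)"])
        (use h N in \<open>auto simp: B_comb_left Q_comb_left comb_closed\<close>)
  qed
  from this[of "Suc n"] show ?thesis using that unfolding lessThan_Suc_atMost by auto
qed

end

text \<open>Turns near-minimality into a first-order condition: dividing by \<open>t\<close> gives
  \<open>\<bar>X m\<bar> \<le> e m / t + t * K\<close>; fix \<open>t\<close> small first, then let
  \<open>m\<close> grow.\<close>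

lemma tendsto_zero_from_quadratic:
  fixes X e :: "nat \<Rightarrow> real"
  assumes le: "\<And>m t. 0 < t \<Longrightarrow> t < 1 \<Longrightarrow> t * \<bar>X m\<bar> \<le> e m + t^2 * K" and e: "e \<longlonglongrightarrow> 0"
  shows "X \<longlonglongrightarrow> 0"
proof (rule LIMSEQ_I)
  fix r :: real assume r: "r > 0"
  \<comment> \<open>The second entry makes \<open>t * K\<close> at most \<open>r / 2\<close>, with
    \<open>+ 1\<close> guarding against \<open>K = 0\<close>; the first keeps
    \<open>t < 1\<close>.\<close>
  define t where "t = min (1/2) (r / (2 * (\<bar>K\<bar> + 1)))"
  have t: "0 < t" "t < 1" using r by (auto simp: t_def)
  have tK: "t * K \<le> r / 2"
  proof -
    have "t * K \<le> t * (\<bar>K\<bar> + 1)" using t by (intro mult_left_mono) auto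
    also have "\<dots> \<le> r / (2 * (\<bar>K\<bar> + 1)) * (\<bar>K\<bar> + 1)" by (intro mult_right_mono) (auto simp: t_def)
    also have "\<dots> = r / 2" by (simp add: field_simps add_eq_0_iff)
    finally show ?thesis .
  qed
  obtain M where M: "\<And>m. m \<ge> M \<Longrightarrow> \<bar>e m\<bar> < t * r / 2"
    using LIMSEQ_D[OF e, of "t * r / 2"] r t by auto
  show "\<exists>no. \<forall>n\<ge>no. norm (X n - 0) < r"
  proof (intro exI allI impI)
    fix m assume "m \<ge> M"
    then have "t * \<bar>X m\<bar> < t * r / 2 + t * (t * K)"
      using le[OF t, of m] M[of m] by (simp add: power2_eq_square)
    also have "\<dots> \<le> t * r / 2 + t * (r / 2)" using tK t by (intro add_left_mono mult_left_mono) auto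
    also have "\<dots> = t * r" by simp
    finally show "norm (X m - 0) < r" using t by simp
  qed
qed

context form_pair begin

text \<open>For a test element \<open>g\<close>, split off its projection onto the frame. Tilting
  along the residual \<open>h\<close> forces \<open>Q (F m k) h\<close> to 0, rotations force the
  off-diagonal entries to 0, and the only surviving term of \<open>Q (F m k) g\<close> is the
  diagonal one, \<open>Q (F m k) (F m k) * B (F m k) g\<close>.\<close>

theorem near_minimal_frames:
  assumes \<psi>: "frame n \<psi>" and w1: "\<And>k. k \<le> n \<Longrightarrow> w k \<ge> 1"
    and w_decr: "\<And>i j. i < j \<Longrightarrow> j \<le> n \<Longrightarrow> w j < w i"
  obtains F where "\<And>m. frame n (F m)"
    and "\<And>m. energy w n (F m) \<le> energy w n \<psi> + 1 / real (Suc m)"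
    and "\<And>g k. g \<in> D \<Longrightarrow> k \<le> n \<Longrightarrow>
      (\<lambda>m. Q (F m k) g - Q (F m k) (F m k) * B (F m k) g) \<longlonglongrightarrow> 0"
proof -
  define S where "S = {energy w n G | G. frame n G}"
  have energy_nonneg: "energy w n G \<ge> 0" if "frame n G" for G
    unfolding energy_def by (intro sum_nonneg mult_nonneg_nonneg Q_nonneg frame_in[OF that])
      (use w1 in force)+
  have bdd: "bdd_below S" by (rule bdd_belowI[of _ 0]) (auto simp: S_def energy_nonneg)
  have ne: "S \<noteq> {}" using \<psi> by (auto simp: S_def)
  have "\<exists>G. frame n G \<and> energy w n G < Inf S + 1 / real (Suc m)" for m
    using cInf_lessD[OF ne, of "Inf S + 1 / real (Suc m)"] by (auto simp: S_def)
  then obtain F where F: "\<And>m. frame n (F m)"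
    and Fle: "\<And>m. energy w n (F m) < Inf S + 1 / real (Suc m)" by metis
  have Inf_le: "Inf S \<le> energy w n G" if "frame n G" for G
    using that by (intro cInf_lower bdd) (auto simp: S_def)
  define C where "C = energy w n \<psi> + 1"
  have bound: "energy w n (F m) \<le> energy w n \<psi> + 1 / real (Suc m)" for m
    using Fle[of m] Inf_le[OF \<psi>] by simp
  have near: "energy w n (F m) - 1 / real (Suc m) \<le> energy w n G" if "frame n G" for m G
    using Fle[of m] Inf_le[OF that] by simp
  define q where "q m i j = Q (F m i) (F m j)" for m i j
  have inD: "F m i \<in> D" if "i \<le> n" for m i using frame_in[OF F that] .
  have q0: "0 \<le> q m i i" if "i \<le> n" for m i unfolding q_def by (rule Q_nonneg[OF inD[OF that]])
  have qC: "q m i i \<le> C" if i: "i \<le> n" for m i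
  proof -
    have "q m i i \<le> w i * q m i i" using mult_right_mono[OF w1[OF i] q0[OF i, of m]] by simp
    also have "\<dots> \<le> energy w n (F m)" unfolding energy_def q_def
      by (rule member_le_sum) (use i w1 Q_nonneg inD in \<open>auto intro!: mult_nonneg_nonneg, force\<close>)
    also have "\<dots> \<le> C" using bound[of m] unfolding C_def
      by (smt (verit) divide_le_eq_1 of_nat_0_less_iff of_nat_Suc of_nat_0_le_iff)
    finally show ?thesis .
  qed
  have e0: "(\<lambda>m. 1 / real (Suc m)) \<longlonglongrightarrow> 0" by (rule LIMSEQ_inverse_real_of_nat[unfolded inverse_eq_divide])

  have off: "(\<lambda>m. q m i j) \<longlonglongrightarrow> 0" if ij: "i < j" "j \<le> n" for i j
  proof -
    have le: "i \<le> n" "i \<noteq> j" using ij by auto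
    define d where "d = w i - w j"
    have d: "d > 0" using w_decr[OF ij] by (simp add: d_def)
    have est: "-(1 / real (Suc m)) / d \<le> s^2 * C + 2 * c * s * q m i j" if cs: "c^2 + s^2 = 1" for m and c s :: real
    proof -
      have "- (1 / real (Suc m)) \<le> d * (s^2 * (q m j j - q m i i) + 2 * c * s * q m i j)"
        using near[OF frame_rotate(1)[OF F le(1) ij(2) le(2) cs], of m m]
        unfolding frame_rotate(2)[OF F le(1) ij(2) le(2) cs] d_def q_def by linarith
      then have "- (1 / real (Suc m)) / d \<le> s^2 * (q m j j - q m i i) + 2 * c * s * q m i j"
        using d by (metis pos_divide_le_eq mult.commute)
      also have "s^2 * (q m j j - q m i i) \<le> s^2 * C"
        using qC[OF ij(2), of m] q0[OF le(1), of m] by (intro mult_left_mono) auto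
      finally show ?thesis by simp
    qed
    have C0: "C \<ge> 0" using q0[OF ij(2), of 0] qC[OF ij(2), of 0] by linarith
    show ?thesis
    proof (rule tendsto_zero_from_quadratic[where e = "\<lambda>m. 1 / real (Suc m) / d" and K = C])
      show "(\<lambda>m. 1 / real (Suc m) / d) \<longlonglongrightarrow> 0" using tendsto_divide[OF e0 tendsto_const[of d]] d by simp
      fix m and t :: real assume t: "0 < t" "t < 1"
      define s where "s = 2 * t / (1 + t^2)"
      define c where "c = (1 - t^2) / (1 + t^2)"
      \<comment> \<open>\<open>s'\<close> and \<open>c'\<close> are sine and cosine of the angle
        with tangent \<open>t\<close>. Rotating by this angle in both directions yields the bound
        with an absolute value; \<open>t \<le> 2 * (t / (1 + t^2))\<close> for \<open>t < 1\<close>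
        then clears the denominators.\<close>
      define s' where "s' = t / sqrt (1 + t^2)"
      define c' where "c' = 1 / sqrt (1 + t^2)"
      have p: "1 + t^2 > 0" by (simp add: add_pos_nonneg)
      have "c'^2 + s'^2 = 1" "c'^2 + (-s')^2 = 1" using p by (auto simp: s'_def c'_def power_divide field_simps)
      from est[OF this(1), of m] est[OF this(2), of m]
      have "2 * \<bar>c' * s' * q m i j\<bar> \<le> 1 / real (Suc m) / d + s'^2 * C" by (simp add: abs_if algebra_simps)
      moreover have "c' * s' = t / (1 + t^2)" "s'^2 = t^2 / (1 + t^2)"
        using p by (auto simp: c'_def s'_def power_divide)
      ultimately have "2 * (t / (1 + t^2)) * \<bar>q m i j\<bar> \<le> 1 / real (Suc m) / d + t^2 / (1 + t^2) * C"
        using t by (simp add: abs_mult)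
      moreover have "t \<le> 2 * (t / (1 + t^2))"
      proof -
        have "t^2 \<le> 1" using t by (simp add: power_le_one)
        then have "t * (1 + t^2) \<le> 2 * t" using t mult_left_mono[of "1 + t^2" 2 t] by simp
        then show ?thesis using p by (simp add: pos_le_divide_eq)
      qed
      moreover have "t^2 / (1 + t^2) * C \<le> t^2 * C"
        using p C0 by (intro mult_right_mono) (auto simp: divide_le_eq mult_le_cancel_left1)
      ultimately show "t * \<bar>q m i j\<bar> \<le> 1 / real (Suc m) / d + t^2 * C"
        by (smt (verit) mult_right_mono abs_ge_zero)
    qed
  qed
  have off': "(\<lambda>m. q m i j) \<longlonglongrightarrow> 0" if "i \<noteq> j" "i \<le> n" "j \<le> n" for i j
    using off[of i j] off[of j i] that Q_sym[OF inD inD, of i j]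
    by (cases "i < j") (auto simp: q_def)

  have main: "(\<lambda>m. Q (F m k) g - q m k k * B (F m k) g) \<longlonglongrightarrow> 0" if g: "g \<in> D" and k: "k \<le> n" for g k
  proof -
    define P where "P m h \<longleftrightarrow> h \<in> D \<and> (\<forall>x\<in>D. B h x = B g x - (\<Sum>j\<le>n. B (F m j) g * B (F m j) x))
        \<and> (\<forall>x\<in>D. Q h x = Q g x - (\<Sum>j\<le>n. B (F m j) g * Q (F m j) x))" for m h
    have "\<exists>h. P m h" for m
      unfolding P_def by (rule frame_residual[OF F g, of m]) blast
    then obtain h where "\<And>m. P m (h m)" by metis
    then have h: "\<And>m. h m \<in> D"
      and hB: "\<And>m x. x \<in> D \<Longrightarrow> B (h m) x = B g x - (\<Sum>j\<le>n. B (F m j) g * B (F m j) x)"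
      and hQ: "\<And>m x. x \<in> D \<Longrightarrow> Q (h m) x = Q g x - (\<Sum>j\<le>n. B (F m j) g * Q (F m j) x)"
      unfolding P_def by blast+
    have orth: "B (h m) (F m j) = 0" if "j \<le> n" for m j
    proof -
      have "(\<Sum>i\<le>n. B (F m i) g * B (F m i) (F m j)) = (\<Sum>i\<le>n. if i = j then B (F m j) g else 0)"
        by (intro sum.cong) (auto simp: frame_B[OF F] that)
      then show ?thesis using hB[OF inD[OF that], of m m] that B_sym[OF g inD[OF that]] by simp
    qed
    have hh: "B (h m) (h m) = B g g - (\<Sum>j\<le>n. (B (F m j) g)^2)" for m
    proof -
      have "B (h m) (h m) = B g (h m)"
        unfolding hB[OF h] using orth[of _ m] B_sym[OF h inD, of _ m m] by simp
      then show ?thesis using hB[OF g, of m] B_sym[OF g h] by (simp add: power2_eq_square)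
    qed
    \<comment> \<open>Bessel's inequality: the coefficients of \<open>g\<close> are bounded
      independently of \<open>m\<close>, which is what makes the constant \<open>K\<close> below
      uniform.\<close>
    have bessel: "(\<Sum>j\<le>n. (B (F m j) g)^2) \<le> B g g" for m using hh[of m] B_nonneg[OF h, of m] by linarith
    have hhle: "B (h m) (h m) \<le> B g g" for m unfolding hh by (simp add: sum_nonneg)
    have coef: "(B (F m j) g)^2 \<le> B g g" if "j \<le> n" for m j
      using bessel[of m] member_le_sum[of j "{..n}" "\<lambda>j. (B (F m j) g)^2"] that by auto
    define L where "L = sqrt (B g g)"
    have coef': "\<bar>B (F m j) g\<bar> \<le> L" if "j \<le> n" for m j
      using real_sqrt_le_mono[OF coef[OF that, of m]] by (simp add: L_def)
    have CS: "2 * \<bar>Q x y\<bar> \<le> Q x x + Q y y" if "x \<in> D" "y \<in> D" for x y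
      using Q_nonneg[OF comb_closed[OF that, of 1 1]] Q_nonneg[OF comb_closed[OF that, of 1 "-1"]]
        that Q_sym[OF that] by (simp add: comb_closed Q_comb_left Q_comb_right)
    \<comment> \<open>Bounds \<open>Q (h m) (h m)\<close> for all \<open>m\<close>: expand
      \<open>h m\<close> in one slot, then in the other. The three summands bound
      \<open>Q g g\<close> and the two resulting sums, with \<open>L\<close> for coefficients and
      \<open>C\<close> for diagonal entries.\<close>
    define K where "K = Q g g + (\<Sum>j\<le>n. L * (Q g g + C)) + (\<Sum>j\<le>n. L * (Q g g + C + (\<Sum>i\<le>n. L * C)))"
    have C0: "C \<ge> 0" using q0[OF k, of 0] qC[OF k, of 0] by linarith
    have L0: "L \<ge> 0" by (simp add: L_def B_nonneg g)
    have Fg: "\<bar>Q (F m j) g\<bar> \<le> Q g g + C" if "j \<le> n" for m j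
      using CS[OF inD[OF that, of m] g] qC[OF that, of m] Q_nonneg[OF g] C0 by (simp add: q_def)
    have qij: "\<bar>q m i j\<bar> \<le> C" if "i \<le> n" "j \<le> n" for m i j
      using CS[OF inD[OF that(1), of m] inD[OF that(2), of m]] qC[OF that(1), of m] qC[OF that(2), of m] by (simp add: q_def)
    have hQK: "Q (h m) (h m) \<le> K" for m
    proof -
      have a: "\<bar>Q (h m) (F m j)\<bar> \<le> Q g g + C + (\<Sum>i\<le>n. L * C)" if j: "j \<le> n" for j
      proof -
        have "\<bar>\<Sum>i\<le>n. B (F m i) g * q m i j\<bar> \<le> (\<Sum>i\<le>n. L * C)"
          by (rule order_trans[OF sum_abs], rule sum_mono) (use coef' qij j L0 in \<open>auto simp: abs_mult intro!: mult_mono\<close>)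
        then show ?thesis unfolding hQ[OF inD[OF j]] using Fg[OF j, of m] Q_sym[OF g inD[OF j]] by (simp add: q_def)
      qed
      have b: "\<bar>\<Sum>j\<le>n. B (F m j) g * Q (F m j) (h m)\<bar> \<le> (\<Sum>j\<le>n. L * (Q g g + C + (\<Sum>i\<le>n. L * C)))"
        by (rule order_trans[OF sum_abs], rule sum_mono)
          (use coef' a L0 Q_sym[OF h inD] in \<open>auto simp: abs_mult intro!: mult_mono\<close>)
      have c: "\<bar>\<Sum>j\<le>n. B (F m j) g * Q (F m j) g\<bar> \<le> (\<Sum>j\<le>n. L * (Q g g + C))"
        by (rule order_trans[OF sum_abs], rule sum_mono)
          (use coef' Fg L0 in \<open>auto simp: abs_mult intro!: mult_mono\<close>)
      have "Q (h m) (h m) = Q g (h m) - (\<Sum>j\<le>n. B (F m j) g * Q (F m j) (h m))" by (rule hQ[OF h])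
      moreover have "Q g (h m) = Q g g - (\<Sum>j\<le>n. B (F m j) g * Q (F m j) g)"
        using hQ[OF g, of m] Q_sym[OF g h] by simp
      ultimately show ?thesis using b c unfolding K_def by linarith
    qed
    have X0: "(\<lambda>m. Q (F m k) (h m)) \<longlonglongrightarrow> 0"
    proof (rule tendsto_zero_from_quadratic[where e = "\<lambda>m. 1 / real (Suc m) * (1 + B g g)" and K = K])
      show "(\<lambda>m. 1 / real (Suc m) * (1 + B g g)) \<longlonglongrightarrow> 0" using tendsto_mult[OF e0 tendsto_const] by simp
      fix m and t :: real assume t: "0 < t" "t < 1"
      define X where "X = Q (F m k) (h m)"
      define b where "b = B (h m) (h m)"
      define e where "e = 1 / real (Suc m)"
      have b0: "b \<ge> 0" by (simp add: b_def B_nonneg h)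
      have e: "e \<ge> 0" by (simp add: e_def)
      have est: "- (2 * s * X) \<le> e * (1 + B g g) + s^2 * K" if s: "s^2 \<le> 1" for s
      proof -
        define R where "R = (q m k k + 2 * s * X + s^2 * Q (h m) (h m)) / (1 + s^2 * b)"
        have pos: "1 + s^2 * b > 0" using b0 by (simp add: add_pos_nonneg)
        define G where "G = (F m)(k := comb (1 / sqrt (1 + s^2 * b)) (F m k) (s / sqrt (1 + s^2 * b)) (h m))"
        have "frame n G" unfolding G_def b_def by (rule frame_tilt(1)[OF F k h]) (rule orth)
        moreover have "energy w n G = energy w n (F m) + w k * (R - q m k k)"
          unfolding G_def b_def R_def X_def q_def by (rule frame_tilt(2)[OF F k h]) (rule orth)
        ultimately have "- e \<le> w k * (R - q m k k)" using near[of G m] by (simp add: e_def)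
        \<comment> \<open>If \<open>R - q m k k\<close> is negative, removing a factor
          \<open>w k\<close> that is at least 1 only brings it closer to 0.\<close>
        then have "- e \<le> R - q m k k"
          using w1[OF k] e by (smt (verit) mult_less_cancel_right1 mult_minus_left mult_nonneg_nonneg)
        then have "(q m k k - e) * (1 + s^2 * b) \<le> q m k k + 2 * s * X + s^2 * Q (h m) (h m)"
          unfolding R_def using pos by (simp add: pos_le_divide_eq[symmetric])
        moreover have "s^2 * b * q m k k \<ge> 0" using b0 q0[OF k] by simp
        moreover have "s^2 * Q (h m) (h m) \<le> s^2 * K" by (intro mult_left_mono hQK) simp
        moreover have "s^2 * b \<le> B g g" using s hhle[of m] b0 B_nonneg[OF g]
          by (metis b_def mult_left_le_one_le order_trans zero_le_power2)
        then have "e * (1 + s^2 * b) \<le> e * (1 + B g g)" using e by (intro mult_left_mono) auto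
        ultimately show ?thesis by (simp add: algebra_simps)
      qed
      have "t^2 \<le> 1" using t by (simp add: power_le_one)
      with est[of t] est[of "-t"] have "2 * (t * \<bar>X\<bar>) \<le> e * (1 + B g g) + t^2 * K"
        by (simp add: abs_if)
      moreover have "t * \<bar>X\<bar> \<ge> 0" using t by simp
      ultimately show "t * \<bar>Q (F m k) (h m)\<bar> \<le> 1 / real (Suc m) * (1 + B g g) + t^2 * K"
        unfolding X_def e_def by linarith
    qed
    have eq: "Q (F m k) g - q m k k * B (F m k) g = Q (F m k) (h m) + (\<Sum>j\<in>{..n}-{k}. B (F m j) g * q m j k)" for m
      unfolding Q_sym[OF inD[OF k] h] hQ[OF inD[OF k]] using k
      by (subst sum.remove[of "{..n}" k]) (auto simp: q_def Q_sym[OF g inD[OF k]])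
    have "(\<lambda>m. B (F m j) g * q m j k) \<longlonglongrightarrow> 0" if j: "j \<in> {..n}-{k}" for j
    proof (rule Lim_null_comparison)
      show "\<forall>\<^sub>F m in sequentially. norm (B (F m j) g * q m j k) \<le> L * \<bar>q m j k\<bar>"
        using j coef' by (auto simp: abs_mult intro!: always_eventually mult_right_mono)
      show "(\<lambda>m. L * \<bar>q m j k\<bar>) \<longlonglongrightarrow> 0"
        using tendsto_mult[OF tendsto_const tendsto_rabs_zero[OF off'[of j k]], of L] j k by auto
    qed
    then have "(\<lambda>m. \<Sum>j\<in>{..n}-{k}. B (F m j) g * q m j k) \<longlonglongrightarrow> 0"
      by (rule tendsto_null_sum)
    from tendsto_add[OF X0 this] show ?thesis unfolding eq by simp
  qed
  show ?thesis
    by (rule that[of F]) (use F bound main in \<open>auto simp: q_def\<close>)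
qed

end

section \<open>Hermite functions\<close>

definition density_bound :: "nat \<Rightarrow> real" where
  "density_bound n = (if odd n
     then (2 * real n + 3) / (real n + 1) * Gamma (real n / 2 + 1) / Gamma ((real n + 1) / 2)
     else (real n + 1) * Gamma ((real n + 1) / 2) / Gamma (real n / 2 + 1))"

lemma chi_eq: "chi n = density_bound n - (\<Sum>k\<le>n. 1 / sqrt (lam0 k))"
  by (simp add: chi_def density_bound_def)

text \<open>The orthonormal eigenfunctions of the harmonic oscillator, given directly by the
  normalised three-term recurrence, so that no factors \<open>2 ^ k\<close> or factorials occur. The
  constant in the first equation is pi to the power -1/4.\<close>

fun hermite_fun :: "nat \<Rightarrow> real \<Rightarrow> real" where
  "hermite_fun 0 x = exp (- x\<^sup>2 / 2) / sqrt (sqrt pi)"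
| "hermite_fun (Suc 0) x = sqrt 2 * x * hermite_fun 0 x"
| "hermite_fun (Suc (Suc k)) x =
     (sqrt 2 * x * hermite_fun (Suc k) x - sqrt (real (Suc k)) * hermite_fun k x) / sqrt (real (Suc (Suc k)))"

declare hermite_fun.simps [simp del]

text \<open>The lowering relation, taken as definition of the derivative. At \<open>k = 0\<close>
  the truncated index \<open>k - 1\<close> is 0 and the factor \<open>sqrt (real k)\<close> removes
  the term.\<close>

definition hermite_fun' :: "nat \<Rightarrow> real \<Rightarrow> real" where
  "hermite_fun' k x = sqrt 2 * sqrt (real k) * hermite_fun (k - 1) x - x * hermite_fun k x"

lemma hermite_fun_rec:
  "sqrt (real (Suc k)) * hermite_fun (Suc k) x = sqrt 2 * x * hermite_fun k x - sqrt (real k) * hermite_fun (k - 1) x"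
  by (cases k) (simp_all add: hermite_fun.simps)

text \<open>Differentiating the recurrence produces neighbouring Hermite functions; applying the
  recurrence at two consecutive indices collapses them to the lowering relation at the next
  index.\<close>

lemma hermite_fun_deriv: "(hermite_fun k has_real_derivative hermite_fun' k x) (at x)"
proof (induction k x rule: hermite_fun.induct)
  case (1 x)
  show ?case unfolding hermite_fun.simps hermite_fun'_def
    by (auto intro!: derivative_eq_intros simp: field_simps)
next
  case (2 x)
  have "(\<lambda>x. hermite_fun (Suc 0) x) = (\<lambda>x. sqrt 2 * x * hermite_fun 0 x)" by (auto simp: hermite_fun.simps)
  moreover have "((\<lambda>x. sqrt 2 * x * hermite_fun 0 x) has_real_derivative
      sqrt 2 * hermite_fun 0 x + sqrt 2 * x * hermite_fun' 0 x) (at x)"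
    using 2 by (auto intro!: derivative_eq_intros)
  moreover have "sqrt 2 * hermite_fun 0 x + sqrt 2 * x * hermite_fun' 0 x = hermite_fun' (Suc 0) x"
    by (simp add: hermite_fun'_def hermite_fun.simps(2))
  ultimately show ?case by simp
next
  case (3 k x)
  define r where "r = sqrt (real (Suc (Suc k)))"
  define s where "s = sqrt (real (Suc k))"
  have r: "r > 0" "r * r = s * s + 1" by (auto simp: r_def s_def)
  have eq: "hermite_fun (Suc (Suc k)) = (\<lambda>x. (sqrt 2 * x * hermite_fun (Suc k) x - s * hermite_fun k x) / r)"
    by (auto simp: r_def s_def hermite_fun.simps)
  have "(hermite_fun (Suc (Suc k)) has_real_derivative
      (sqrt 2 * hermite_fun (Suc k) x + sqrt 2 * x * hermite_fun' (Suc k) x - s * hermite_fun' k x) / r) (at x)"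
    unfolding eq using 3 r(1)
    by (intro DERIV_cdivide) (auto intro!: derivative_eq_intros simp: algebra_simps)
  moreover have "(sqrt 2 * hermite_fun (Suc k) x + sqrt 2 * x * hermite_fun' (Suc k) x - s * hermite_fun' k x) / r
      = hermite_fun' (Suc (Suc k)) x"
  proof -
    have rec1: "s * hermite_fun (Suc k) x = sqrt 2 * x * hermite_fun k x - sqrt (real k) * hermite_fun (k - 1) x"
      unfolding s_def by (rule hermite_fun_rec)
    have rec2: "r * hermite_fun (Suc (Suc k)) x = sqrt 2 * x * hermite_fun (Suc k) x - s * hermite_fun k x"
      unfolding s_def r_def using hermite_fun_rec[of "Suc k" x] by simp
    have d1: "hermite_fun' (Suc k) x = sqrt 2 * s * hermite_fun k x - x * hermite_fun (Suc k) x"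
      and d0: "hermite_fun' k x = sqrt 2 * sqrt (real k) * hermite_fun (k - 1) x - x * hermite_fun k x"
      and d2: "hermite_fun' (Suc (Suc k)) x = sqrt 2 * r * hermite_fun (Suc k) x - x * hermite_fun (Suc (Suc k)) x"
      by (simp_all add: hermite_fun'_def s_def r_def)
    have "sqrt 2 * hermite_fun (Suc k) x + sqrt 2 * x * hermite_fun' (Suc k) x - s * hermite_fun' k x
       = sqrt 2 * hermite_fun (Suc k) x + sqrt 2 * s * (sqrt 2 * x * hermite_fun k x - sqrt (real k) * hermite_fun (k - 1) x)
         - x * (sqrt 2 * x * hermite_fun (Suc k) x - s * hermite_fun k x)"
      unfolding d1 d0 by (simp add: algebra_simps)
    also have "\<dots> = sqrt 2 * hermite_fun (Suc k) x + sqrt 2 * s * (s * hermite_fun (Suc k) x) - x * (r * hermite_fun (Suc (Suc k)) x)"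
      unfolding rec1 rec2 ..
    also have "\<dots> = sqrt 2 * (s * s + 1) * hermite_fun (Suc k) x - x * (r * hermite_fun (Suc (Suc k)) x)"
      by (simp add: algebra_simps)
    also have "\<dots> = r * hermite_fun' (Suc (Suc k)) x"
      unfolding d2 r(2)[symmetric] by (simp add: algebra_simps)
    finally show ?thesis using r by simp
  qed
  ultimately show ?case by simp
qed

text \<open>The creation operator \<open>x - d/dx\<close>; \<open>hermite_fun_lower\<close> is the
  annihilation operator. Orthogonality and energies follow from this pair by algebra.\<close>

lemma hermite_fun_raise:
  "x * hermite_fun k x - hermite_fun' k x = sqrt 2 * sqrt (real (Suc k)) * hermite_fun (Suc k) x"
proof -
  have "sqrt 2 * sqrt (real (Suc k)) * hermite_fun (Suc k) x
      = sqrt 2 * (sqrt 2 * x * hermite_fun k x - sqrt (real k) * hermite_fun (k - 1) x)"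
    using hermite_fun_rec[of k x] by (simp add: mult.assoc)
  then show ?thesis by (simp add: hermite_fun'_def algebra_simps)
qed

lemma hermite_fun_lower:
  "x * hermite_fun k x + hermite_fun' k x = sqrt 2 * sqrt (real k) * hermite_fun (k - 1) x"
  by (simp add: hermite_fun'_def)

section \<open>Polynomials times Gaussians, and orthonormality of the Hermite functions\<close>

lemma hermite_fun_poly: "\<exists>p. \<forall>x. hermite_fun k x = poly p x * exp (- x\<^sup>2 / 2)"
proof (induction k rule: induct_nat_012)
  case 0
  show ?case by (rule exI[of _ "[:1 / sqrt (sqrt pi):]"]) (simp add: hermite_fun.simps)
next
  case 1
  show ?case by (rule exI[of _ "[:0, sqrt 2 / sqrt (sqrt pi):]"]) (simp add: hermite_fun.simps)
next
  case (ge2 k)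
  then obtain p q where p: "\<forall>x. hermite_fun k x = poly p x * exp (- x\<^sup>2 / 2)"
    and q: "\<forall>x. hermite_fun (Suc k) x = poly q x * exp (- x\<^sup>2 / 2)" by blast
  show ?case
    by (rule exI[of _ "smult (1 / sqrt (real (Suc (Suc k)))) ([:0, sqrt 2:] * q - smult (sqrt (real (Suc k))) p)"])
      (use p q in \<open>auto simp: hermite_fun.simps field_simps\<close>)
qed

lemma integrable_monom_gauss: "integrable lborel (\<lambda>x::real. x ^ k * exp (- x\<^sup>2))"
proof (rule Bochner_Integration.integrable_bound[where f = "\<lambda>x. sqrt (2 * pi) * (std_normal_density x * \<bar>x\<bar> ^ k)"])
  show "integrable lborel (\<lambda>x. sqrt (2 * pi) * (std_normal_density x * \<bar>x\<bar> ^ k))"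
    by (intro integrable_mult_right integrable_std_normal_moment_abs)
  show "AE x in lborel. norm (x ^ k * exp (- x\<^sup>2)) \<le> norm (sqrt (2 * pi) * (std_normal_density x * \<bar>x\<bar> ^ k))"
    proof (intro AE_I2)
    fix x :: real
    have "\<bar>x\<bar> ^ k * exp (- x\<^sup>2) \<le> \<bar>x\<bar> ^ k * exp (- (x\<^sup>2 / 2))" by (intro mult_left_mono) auto
    then show "norm (x ^ k * exp (- x\<^sup>2)) \<le> norm (sqrt (2 * pi) * (std_normal_density x * \<bar>x\<bar> ^ k))"
      by (simp add: abs_mult power_abs std_normal_density_def mult.commute)
  qed
qed simp

lemma integrable_poly_gauss: "integrable lborel (\<lambda>x::real. poly p x * exp (- x\<^sup>2))"
  unfolding poly_altdef sum_distrib_right mult.assoc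
  by (intro Bochner_Integration.integrable_sum integrable_mult_right integrable_monom_gauss)

lemma monom_gauss_at_top: "((\<lambda>x::real. x ^ k * exp (- x\<^sup>2)) \<longlongrightarrow> 0) at_top"
proof (rule Lim_null_comparison[OF _ tendsto_power_div_exp_0[of k]])
  show "\<forall>\<^sub>F x in at_top. norm (x ^ k * exp (- x\<^sup>2)) \<le> x ^ k / exp x"
    using eventually_ge_at_top[of "1::real"]
  proof eventually_elim
    case (elim x)
    then have "exp (- x\<^sup>2) \<le> exp (- x)" by (simp add: power2_eq_square)
    then show ?case using elim mult_left_mono[of "exp (- x\<^sup>2)" "exp (-x)" "x ^ k"] by (simp add: abs_mult exp_minus field_simps)
  qed
qed

lemma poly_gauss_at_top: "((\<lambda>x::real. poly p x * exp (- x\<^sup>2)) \<longlongrightarrow> 0) at_top"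
  unfolding poly_altdef sum_distrib_right mult.assoc
  by (intro tendsto_null_sum tendsto_mult_right_zero monom_gauss_at_top)

lemma poly_gauss_at_bot: "((\<lambda>x::real. poly p x * exp (- x\<^sup>2)) \<longlongrightarrow> 0) at_bot"
  using poly_gauss_at_top[of "pcompose p [:0, -1:]"]
  by (simp add: filterlim_at_bot_mirror poly_pcompose)

text \<open>The derivative of a polynomial times a Gaussian has the same shape, hence is integrable,
  and the boundary values at both infinities vanish. Applied to products of Hermite functions this
  is integration by parts on the line.\<close>

lemma integral_deriv_poly_gauss:
  assumes F: "\<And>x. F x = poly p x * exp (- x\<^sup>2)" and d: "\<And>x. (F has_real_derivative F' x) (at x)"
  shows "integrable lborel F'" and "integral\<^sup>L lborel F' = 0"
proof -
  have "F = (\<lambda>x. poly p x * exp (- x\<^sup>2))" using F by auto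
  then have "(F has_real_derivative poly (pderiv p - [:0, 2:] * p) x * exp (- x\<^sup>2)) (at x)" for x
    by (auto intro!: derivative_eq_intros poly_DERIV simp: algebra_simps)
  then have F': "F' = (\<lambda>x. poly (pderiv p - [:0, 2:] * p) x * exp (- x\<^sup>2))"
    using d DERIV_unique by blast
  show int: "integrable lborel F'" unfolding F' by (rule integrable_poly_gauss)
  have "(LBINT x=-\<infinity>..\<infinity>. F' x) = 0 - 0"
  proof (rule interval_integral_FTC_integrable)
    show "(F has_vector_derivative F' x) (at x)" for x using d by (simp add: has_real_derivative_iff_has_vector_derivative)
    show "isCont F' x" for x unfolding F' by (intro continuous_intros)
    show "set_integrable lborel (einterval (- \<infinity>) \<infinity>) F'" using int by (simp add: set_integrable_def)
    show "((F \<circ> real_of_ereal) \<longlongrightarrow> 0) (at_right (- \<infinity>))" "((F \<circ> real_of_ereal) \<longlongrightarrow> 0) (at_left \<infinity>)"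
      using poly_gauss_at_top[of p] poly_gauss_at_bot[of p] \<open>F = _\<close> by (simp_all add: ereal_tendsto_simps)
  qed simp
  then show "integral\<^sup>L lborel F' = 0"
    by (simp add: interval_lebesgue_integral_def set_lebesgue_integral_def)
qed

lemma hermite_fun_prod_poly: "\<exists>p. \<forall>x. hermite_fun i x * hermite_fun j x = poly p x * exp (- x\<^sup>2)"
proof -
  obtain p q where p: "\<forall>x. hermite_fun i x = poly p x * exp (- x\<^sup>2 / 2)"
    and q: "\<forall>x. hermite_fun j x = poly q x * exp (- x\<^sup>2 / 2)" using hermite_fun_poly by meson
  have e: "exp (- x\<^sup>2) = exp (- x\<^sup>2 / 2) * exp (- x\<^sup>2 / 2)" for x :: real by (simp add: exp_add[symmetric])
  show ?thesis
    by (rule exI[of _ "p * q"]) (simp only: p[rule_format] q[rule_format] e poly_mult mult_ac simp_thms)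
qed

lemma integrable_hermite_prod [intro]: "integrable lborel (\<lambda>x. hermite_fun i x * hermite_fun j x)"
  using hermite_fun_prod_poly[of i j] integrable_poly_gauss by auto

lemma integral_hermite_by_parts:
  shows "integrable lborel (\<lambda>x. hermite_fun' i x * hermite_fun j x + hermite_fun i x * hermite_fun' j x)"
    and "(\<integral>x. hermite_fun' i x * hermite_fun j x + hermite_fun i x * hermite_fun' j x \<partial>lborel) = 0"
proof -
  obtain p where p: "\<And>x. hermite_fun i x * hermite_fun j x = poly p x * exp (- x\<^sup>2)"
    using hermite_fun_prod_poly[of i j] by blast
  have d: "((\<lambda>x. hermite_fun i x * hermite_fun j x) has_real_derivative
      hermite_fun' i x * hermite_fun j x + hermite_fun i x * hermite_fun' j x) (at x)" for x
    using DERIV_mult[OF hermite_fun_deriv[of i x] hermite_fun_deriv[of j x]] by (simp add: algebra_simps)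
  from integral_deriv_poly_gauss[OF p d]
  show "integrable lborel (\<lambda>x. hermite_fun' i x * hermite_fun j x + hermite_fun i x * hermite_fun' j x)"
    and "(\<integral>x. hermite_fun' i x * hermite_fun j x + hermite_fun i x * hermite_fun' j x \<partial>lborel) = 0" by auto
qed

text \<open>Creation and annihilation are adjoint: the derivative of a product \<open>f * g\<close>
  equals \<open>f * (x * g + g') - (x * f - f') * g\<close> and integrates to 0.\<close>

lemma hermite_shift:
  "sqrt (real (Suc i)) * (\<integral>x. hermite_fun (Suc i) x * hermite_fun j x \<partial>lborel)
    = sqrt (real j) * (\<integral>x. hermite_fun i x * hermite_fun (j - 1) x \<partial>lborel)"
proof -
  have eq: "sqrt 2 * sqrt (real j) * (hermite_fun i x * hermite_fun (j - 1) x) - sqrt 2 * sqrt (real (Suc i)) * (hermite_fun (Suc i) x * hermite_fun j x)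
     = hermite_fun' i x * hermite_fun j x + hermite_fun i x * hermite_fun' j x" for x
    using hermite_fun_raise[of x i] hermite_fun_lower[of x j] by (algebra)
  have "sqrt 2 * sqrt (real j) * (\<integral>x. hermite_fun i x * hermite_fun (j - 1) x \<partial>lborel)
      - sqrt 2 * sqrt (real (Suc i)) * (\<integral>x. hermite_fun (Suc i) x * hermite_fun j x \<partial>lborel) = 0"
    unfolding integral_hermite_by_parts(2)[of i j, symmetric] eq[symmetric]
    by (subst Bochner_Integration.integral_diff) (auto)
  then show ?thesis by (simp add: mult.assoc)
qed

text \<open>\<open>hermite_shift\<close> lowers both indices together until one reaches 0. Then
  either both are 0, a Gaussian integral, or the factor \<open>sqrt 0\<close> appears.\<close>

lemma hermite_orthonormal:
  "(\<integral>x. hermite_fun i x * hermite_fun j x \<partial>lborel) = (if i = j then 1 else 0)"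
proof (induction i arbitrary: j)
  case 0
  show ?case
  proof (cases j)
    case 0
    have sq: "hermite_fun 0 x * hermite_fun 0 x = exp (- x\<^sup>2) / sqrt pi" for x
    proof -
      have "sqrt (sqrt pi) * sqrt (sqrt pi) = sqrt pi" by simp
      moreover have "exp (- x\<^sup>2 / 2) * exp (- x\<^sup>2 / 2) = exp (- x\<^sup>2)" by (simp add: exp_add[symmetric])
      ultimately show ?thesis by (simp add: hermite_fun.simps)
    qed
    have "has_bochner_integral lborel (\<lambda>x::real. exp (- x\<^sup>2)) (2 *\<^sub>R (sqrt pi / 2))"
      by (rule has_bochner_integral_even_function[OF gaussian_moment_0]) simp
    then have "(\<integral>x. exp (- x\<^sup>2) \<partial>lborel) = sqrt pi" using has_bochner_integral_integral_eq by fastforce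
    then show ?thesis unfolding 0 sq by simp
  next
    case (Suc j')
    have "(\<integral>x. hermite_fun (Suc j') x * hermite_fun 0 x \<partial>lborel) = 0"
      using hermite_shift[of j' 0] by simp
    then show ?thesis using Suc by (simp add: mult.commute)
  qed
next
  case (Suc i)
  show ?case
  proof (cases j)
    case 0
    then show ?thesis using hermite_shift[of i 0] by simp
  next
    case (Suc j')
    have "sqrt (real (Suc i)) * (\<integral>x. hermite_fun (Suc i) x * hermite_fun j x \<partial>lborel)
       = sqrt (real j) * (if i = j' then 1 else 0)"
      using hermite_shift[of i j] Suc.IH[of j'] Suc by simp
    then show ?thesis using Suc by (auto split: if_splits)
  qed
qed

text \<open>The derivative and the product with \<open>x\<close> are half the difference and half
  the sum of \<open>a * u\<close> and \<open>b * v\<close>, with \<open>u\<close>, \<open>v\<close>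
  orthonormal. So both integrals equal \<open>(a * a + b * b) / 4\<close>. For \<open>k = 0\<close>
  the function \<open>u\<close> is \<open>hermite_fun 0\<close>, but \<open>a = 0\<close>.\<close>

lemma hermite_energy:
  shows "integrable lborel (\<lambda>x. (hermite_fun' k x)\<^sup>2)"
    and "integrable lborel (\<lambda>x. x\<^sup>2 * (hermite_fun k x)\<^sup>2)"
    and "(\<integral>x. (hermite_fun' k x)\<^sup>2 \<partial>lborel) + (\<integral>x. x\<^sup>2 * (hermite_fun k x)\<^sup>2 \<partial>lborel) = 2 * real k + 1"
proof -
  define a where "a = sqrt 2 * sqrt (real k)"
  define b where "b = sqrt 2 * sqrt (real (Suc k))"
  define u where "u = hermite_fun (k - 1)"
  define v where "v = hermite_fun (Suc k)"
  have ab: "a * a = 2 * real k" "b * b = 2 * real k + 2"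
    by (simp_all add: a_def b_def flip: real_sqrt_mult)
  have d: "hermite_fun' k x = (a * u x - b * v x) / 2" and m: "x * hermite_fun k x = (a * u x + b * v x) / 2" for x
    using hermite_fun_raise[of x k] hermite_fun_lower[of x k] unfolding a_def b_def u_def v_def by (simp_all add: field_simps)
  have uu: "integrable lborel (\<lambda>x. u x * u x)" and vv: "integrable lborel (\<lambda>x. v x * v x)" and uv: "integrable lborel (\<lambda>x. u x * v x)"
    unfolding u_def v_def by (rule integrable_hermite_prod)+
  have dd: "(hermite_fun' k x)\<^sup>2 = (a * a * (u x * u x) - 2 * a * b * (u x * v x) + b * b * (v x * v x)) / 4" for x
    unfolding d by (simp add: power2_eq_square field_simps)
  have mm: "x\<^sup>2 * (hermite_fun k x)\<^sup>2 = (a * a * (u x * u x) + 2 * a * b * (u x * v x) + b * b * (v x * v x)) / 4" for x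
    unfolding power_mult_distrib[symmetric] m by (simp add: power2_eq_square field_simps)
  have n: "(\<integral>x. u x * u x \<partial>lborel) = 1" "(\<integral>x. v x * v x \<partial>lborel) = 1" "(\<integral>x. u x * v x \<partial>lborel) = 0"
    unfolding u_def v_def by (simp_all add: hermite_orthonormal)
  show 1: "integrable lborel (\<lambda>x. (hermite_fun' k x)\<^sup>2)" and 2: "integrable lborel (\<lambda>x. x\<^sup>2 * (hermite_fun k x)\<^sup>2)"
    unfolding dd mm using uu vv uv by auto
  show "(\<integral>x. (hermite_fun' k x)\<^sup>2 \<partial>lborel) + (\<integral>x. x\<^sup>2 * (hermite_fun k x)\<^sup>2 \<partial>lborel) = 2 * real k + 1"
    unfolding dd mm using uu vv uv by (simp add: n ab)
qed

section \<open>The density of the first Hermite functions and its value at the origin\<close>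

definition hermite_density :: "nat \<Rightarrow> real \<Rightarrow> real" where
  "hermite_density n x = (\<Sum>k\<le>n. (hermite_fun k x)\<^sup>2)"

lemma hermite_sq_deriv:
  "((\<lambda>x. (hermite_fun k x)\<^sup>2) has_real_derivative 2 * hermite_fun k x * hermite_fun' k x) (at x)"
  using DERIV_power[OF hermite_fun_deriv, of k 2] by (simp add: mult_ac)

text \<open>A differentiated Christoffel-Darboux formula: by the lowering relation and the
  recurrence, the derivative of each new square telescopes with the previous product of
  neighbours.\<close>

lemma hermite_density_deriv:
  "(hermite_density n has_real_derivative
     - (sqrt 2 * sqrt (real (Suc n)) * hermite_fun n x * hermite_fun (Suc n) x)) (at x)"
proof (induction n)
  case 0
  have "hermite_density 0 = (\<lambda>x. (hermite_fun 0 x)\<^sup>2)" by (simp add: hermite_density_def fun_eq_iff)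
  moreover have "2 * hermite_fun 0 x * hermite_fun' 0 x = - (sqrt 2 * sqrt (real (Suc 0)) * hermite_fun 0 x * hermite_fun (Suc 0) x)"
    by (simp add: hermite_fun'_def hermite_fun.simps(2))
  ultimately show ?case using hermite_sq_deriv[of 0 x] by simp
next
  case (Suc n)
  define r where "r = sqrt (real (Suc (Suc n)))"
  define s where "s = sqrt (real (Suc n))"
  have eq: "hermite_density (Suc n) = (\<lambda>x. hermite_density n x + (hermite_fun (Suc n) x)\<^sup>2)"
    by (simp add: hermite_density_def fun_eq_iff)
  have r: "r * hermite_fun (Suc (Suc n)) x = sqrt 2 * x * hermite_fun (Suc n) x - s * hermite_fun n x"
    using hermite_fun_rec[of "Suc n" x] by (simp add: r_def s_def)
  have "sqrt 2 * r * hermite_fun (Suc n) x * hermite_fun (Suc (Suc n)) x = sqrt 2 * hermite_fun (Suc n) x * (r * hermite_fun (Suc (Suc n)) x)"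
    by (simp only: mult_ac)
  also have "\<dots> = (sqrt 2 * sqrt 2) * x * hermite_fun (Suc n) x * hermite_fun (Suc n) x - sqrt 2 * s * hermite_fun n x * hermite_fun (Suc n) x"
    unfolding r by (simp only: right_diff_distrib mult_ac)
  finally have "- (sqrt 2 * s * hermite_fun n x * hermite_fun (Suc n) x) + 2 * hermite_fun (Suc n) x * hermite_fun' (Suc n) x
     = - (sqrt 2 * r * hermite_fun (Suc n) x * hermite_fun (Suc (Suc n)) x)"
    by (simp add: hermite_fun'_def s_def algebra_simps)
  moreover have "(hermite_density (Suc n) has_real_derivative
      - (sqrt 2 * s * hermite_fun n x * hermite_fun (Suc n) x) + 2 * hermite_fun (Suc n) x * hermite_fun' (Suc n) x) (at x)"
    unfolding eq s_def by (intro DERIV_add Suc.IH hermite_sq_deriv)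
  ultimately show ?case by (simp only: r_def)
qed

text \<open>The derivative of one density is a product of neighbouring functions without a definite
  sign. For the sum of two consecutive densities, the left-hand side here, the recurrence turns it
  into \<open>- 2 * x\<close> times a square.\<close>

lemma hermite_density_mean_max:
  "2 * hermite_density n x + (hermite_fun (Suc n) x)\<^sup>2 \<le> 2 * hermite_density n 0 + (hermite_fun (Suc n) 0)\<^sup>2"
proof -
  define T where "T x = 2 * hermite_density n x + (hermite_fun (Suc n) x)\<^sup>2" for x
  have T: "(T has_real_derivative - 2 * x * (hermite_fun (Suc n) x)\<^sup>2) (at x)" for x
  proof -
    have "(T has_real_derivative 2 * (- (sqrt 2 * sqrt (real (Suc n)) * hermite_fun n x * hermite_fun (Suc n) x))
        + 2 * hermite_fun (Suc n) x * hermite_fun' (Suc n) x) (at x)"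
      unfolding T_def by (intro DERIV_add DERIV_cmult hermite_density_deriv hermite_sq_deriv)
    then show ?thesis unfolding hermite_fun'_def diff_Suc_1
      by (rule DERIV_cong) (simp add: algebra_simps power2_eq_square)
  qed
  have "T x \<le> T 0"
  proof (cases "x \<ge> 0")
    case True
    show ?thesis
    proof (rule DERIV_nonpos_imp_nonincreasing[OF True])
      fix y :: real assume "0 \<le> y"
      then have "- 2 * y * (hermite_fun (Suc n) y)\<^sup>2 \<le> 0" by (simp add: mult_nonneg_nonneg)
      then show "\<exists>d. (T has_real_derivative d) (at y) \<and> d \<le> 0" using T by blast
    qed
  next
    case False
    then have "x \<le> 0" by simp
    then show ?thesis
    proof (rule DERIV_nonneg_imp_nondecreasing)
      fix y :: real assume "y \<le> 0"
      then have "- 2 * y * (hermite_fun (Suc n) y)\<^sup>2 \<ge> 0" by (simp add: mult_le_0_iff)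
      then show "\<exists>d. (T has_real_derivative d) (at y) \<and> 0 \<le> d" using T by blast
    qed
  qed
  then show ?thesis by (simp add: T_def)
qed

lemma hermite_fun_odd_0: "hermite_fun (2 * m + 1) 0 = 0"
  by (induction m) (simp_all add: hermite_fun.simps)

text \<open>At 0 the middle term of the recurrence drops out, so each step multiplies the square by
  \<open>(2m + 1) / (2m + 2)\<close>, which is also the step of the Gamma quotient.\<close>

lemma hermite_fun_even_0: "(hermite_fun (2 * m) 0)\<^sup>2 = Gamma (real m + 1/2) / (pi * Gamma (real m + 1))"
proof (induction m)
  case 0
  show ?case by (simp add: hermite_fun.simps power_divide Gamma_one_half_real real_sqrt_divide real_div_sqrt field_simps)
next
  case (Suc m)
  have g1: "Gamma (real m + 1/2 + 1) = (real m + 1/2) * Gamma (real m + 1/2)" by (intro Gamma_plus1) (auto elim!: nonpos_Ints_cases)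
  have g2: "Gamma (real m + 1 + 1) = (real m + 1) * Gamma (real m + 1)" by (intro Gamma_plus1) (auto elim!: nonpos_Ints_cases)
  have g0: "Gamma (real m + 1) > 0" by (intro Gamma_real_pos) auto
  have "(hermite_fun (2 * Suc m) 0)\<^sup>2 = real (2 * m + 1) / real (2 * m + 2) * (hermite_fun (2 * m) 0)\<^sup>2"
    by (simp add: hermite_fun.simps power_divide power_mult_distrib)
  also have "\<dots> = ((real m + 1/2) * Gamma (real m + 1/2)) / (pi * ((real m + 1) * Gamma (real m + 1)))"
    unfolding Suc.IH using g0 by (simp add: field_simps)
  also have "\<dots> = Gamma (real m + 1/2 + 1) / (pi * Gamma (real m + 1 + 1))" unfolding g1 g2 ..
  also have "real m + 1/2 + 1 = real (Suc m) + 1/2" by simp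
  also have "real m + 1 + 1 = real (Suc m) + 1" by simp
  finally show ?case .
qed

text \<open>Odd indices contribute nothing. Up to the factor \<open>1 / sqrt pi\<close> this is the
  identity that the sum of \<open>(2j choose j) / 4 ^ j\<close> over \<open>j \<le> m\<close> equals
  \<open>(2m + 1) * (2m choose m) / 4 ^ m\<close>.\<close>

lemma hermite_density_even_0:
  "hermite_density (2 * m) 0 = (2 * real m + 1) * (hermite_fun (2 * m) 0)\<^sup>2"
proof (induction m)
  case 0
  show ?case by (simp add: hermite_density_def)
next
  case (Suc m)
  have e: "(hermite_fun (2 * Suc m) 0)\<^sup>2 = (2 * real m + 1) / (2 * real m + 2) * (hermite_fun (2 * m) 0)\<^sup>2"
    by (simp add: hermite_fun.simps power_divide power_mult_distrib add_ac)
  have "hermite_density (2 * Suc m) 0 = hermite_density (2 * m) 0 + (hermite_fun (2 * m + 1) 0)\<^sup>2 + (hermite_fun (2 * Suc m) 0)\<^sup>2"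
    by (simp add: hermite_density_def)
  also have "\<dots> = (2 * real m + 1) * (hermite_fun (2 * m) 0)\<^sup>2 + (2 * real m + 1) / (2 * real m + 2) * (hermite_fun (2 * m) 0)\<^sup>2"
    unfolding Suc.IH hermite_fun_odd_0 e by simp
  also have "\<dots> = (2 * real (Suc m) + 1) * ((2 * real m + 1) / (2 * real m + 2) * (hermite_fun (2 * m) 0)\<^sup>2)"
    by (simp add: field_simps)
  finally show ?case unfolding e .
qed

text \<open>This is where the two cases of \<open>chi\<close> come from. For even \<open>n\<close>
  the added square vanishes at 0. For odd \<open>n\<close> it does not, while the last function in
  the density does; the added square then produces the factor
  \<open>(2n + 3) / (n + 1)\<close>.\<close>

lemma density_bound_eq: "2 * hermite_density n 0 + (hermite_fun (Suc n) 0)\<^sup>2 = 2 * (density_bound n / pi)"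
proof (cases "odd n")
  case False
  then obtain m where n: "n = 2 * m" by (auto elim: evenE)
  have o: "hermite_fun (Suc (2 * m)) 0 = 0" using hermite_fun_odd_0[of m] by simp
  have h: "real m + 1/2 = (2 * real m + 1) / 2" by (simp add: field_simps)
  show ?thesis unfolding n o hermite_density_even_0 hermite_fun_even_0 h
    by (simp add: density_bound_def)
next
  case True
  then obtain m where n: "n = 2 * m + 1" by (auto elim: oddE)
  have g1: "Gamma (real m + 1/2 + 1) = (real m + 1/2) * Gamma (real m + 1/2)" by (intro Gamma_plus1) (auto elim!: nonpos_Ints_cases)
  have g0: "Gamma (real m + 1) > 0" by (intro Gamma_real_pos) auto
  define c where "c = Gamma (real m + 1/2) / Gamma (real m + 1)"
  have h0: "(hermite_fun (2 * m) 0)\<^sup>2 = c / pi" unfolding hermite_fun_even_0 c_def by (simp add: field_simps)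
  have e: "(hermite_fun (Suc (2 * m + 1)) 0)\<^sup>2 = (2 * real m + 1) / (2 * real m + 2) * (hermite_fun (2 * m) 0)\<^sup>2"
    by (simp add: hermite_fun.simps power_divide power_mult_distrib add_ac)
  have d: "hermite_density (2 * m + 1) 0 = hermite_density (2 * m) 0"
    using hermite_fun_odd_0[of m] by (simp add: hermite_density_def)
  have a: "real n / 2 + 1 = real m + 1/2 + 1" "(real n + 1) / 2 = real m + 1" by (auto simp: n field_simps)
  have "density_bound n = (4 * real m + 5) / (2 * real m + 2) * (real m + 1/2) * c"
    using True unfolding density_bound_def a g1 c_def by (simp add: n add_ac)
  moreover have "2 * hermite_density n 0 + (hermite_fun (Suc n) 0)\<^sup>2 =
      (2 * (2 * real m + 1) + (2 * real m + 1) / (2 * real m + 2)) * (c / pi)"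
    unfolding n e d hermite_density_even_0 h0 by (simp only: distrib_right mult.assoc)
  moreover have "2 * (2 * real m + 1) + (2 * real m + 1) / (2 * real m + 2) = 2 * ((4 * real m + 5) / (2 * real m + 2) * (real m + 1/2))"
    by (simp add: divide_simps) (simp add: algebra_simps)
  ultimately show ?thesis by (simp only: times_divide_eq_left times_divide_eq_right mult.assoc)
qed

lemma hermite_density_le: "hermite_density n x \<le> density_bound n / pi"
proof -
  have "2 * hermite_density n x + (hermite_fun (Suc n) x)\<^sup>2 \<le> 2 * (density_bound n / pi)"
    using hermite_density_mean_max[of n x] unfolding density_bound_eq .
  moreover have "(hermite_fun (Suc n) x)\<^sup>2 \<ge> 0" by simp
  ultimately show ?thesis by linarith
qed

section \<open>Asymptotics of the remainder\<close>

text \<open>Log-convexity of Gamma at the midpoint of \<open>y\<close> and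
  \<open>y + 1\<close>.\<close>

lemma Gamma_half_step:
  fixes y :: real assumes y: "y > 0"
  shows "(Gamma (y + 1/2))\<^sup>2 \<le> Gamma y * Gamma (y + 1)"
proof -
  have g: "Gamma y > 0" "Gamma (y + 1) > 0" "Gamma (y + 1/2) > 0"
    using y by (auto intro!: Gamma_real_pos)
  have "(ln \<circ> Gamma) ((1 - 1/2) *\<^sub>R y + (1/2) *\<^sub>R (y + 1)) \<le> (1 - 1/2) * (ln \<circ> Gamma) y + (1/2) * (ln \<circ> Gamma) (y + 1)"
    by (rule convex_onD[OF log_convex_Gamma_real]) (use y in auto)
  moreover have "(1 - 1/2) *\<^sub>R y + (1/2) *\<^sub>R (y + 1) = y + 1/2" by (simp add: field_simps)
  ultimately have "2 * ln (Gamma (y + 1/2)) \<le> ln (Gamma y) + ln (Gamma (y + 1))" by simp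
  then have "ln ((Gamma (y + 1/2))\<^sup>2) \<le> ln (Gamma y * Gamma (y + 1))"
    using g by (simp add: ln_mult ln_realpow)
  then show ?thesis using g by (subst (asm) ln_le_cancel_iff) auto
qed

text \<open>The half step at \<open>x\<close> gives the lower bound, the half step at
  \<open>x + 1/2\<close> the upper one, each after one use of the functional equation.\<close>

lemma Gamma_ratio_bounds:
  fixes x :: real assumes x: "x > 0"
  shows "sqrt x \<le> Gamma (x + 1) / Gamma (x + 1/2)"
    and "Gamma (x + 1) / Gamma (x + 1/2) \<le> sqrt (x + 1/2)"
proof -
  have g: "Gamma x > 0" "Gamma (x + 1) > 0" "Gamma (x + 1/2) > 0"
    using x by (auto intro!: Gamma_real_pos)
  have g1: "Gamma (x + 1) = x * Gamma x" using x by (intro Gamma_plus1) (auto elim!: nonpos_Ints_cases)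
  have g2: "Gamma (x + 1/2 + 1) = (x + 1/2) * Gamma (x + 1/2)" using x by (intro Gamma_plus1) (auto elim!: nonpos_Ints_cases)
  have "x * (Gamma (x + 1/2))\<^sup>2 \<le> (Gamma (x + 1))\<^sup>2"
    using mult_left_mono[OF Gamma_half_step[OF x], of x] x g1 by (simp add: power2_eq_square mult_ac)
  then have "x \<le> (Gamma (x + 1) / Gamma (x + 1/2))\<^sup>2"
    using g by (simp add: power_divide pos_le_divide_eq)
  then show "sqrt x \<le> Gamma (x + 1) / Gamma (x + 1/2)"
    using g by (intro real_le_lsqrt) auto
  have "(Gamma (x + 1))\<^sup>2 \<le> Gamma (x + 1/2) * Gamma (x + 1/2 + 1)"
    using Gamma_half_step[of "x + 1/2"] x by (simp add: add.assoc)
  then have "(Gamma (x + 1))\<^sup>2 \<le> (x + 1/2) * (Gamma (x + 1/2))\<^sup>2"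
    unfolding g2 by (simp add: power2_eq_square mult_ac)
  then have "(Gamma (x + 1) / Gamma (x + 1/2))\<^sup>2 \<le> x + 1/2"
    using g by (simp add: power_divide pos_divide_le_eq)
  then show "Gamma (x + 1) / Gamma (x + 1/2) \<le> sqrt (x + 1/2)"
    by (rule real_le_rsqrt)
qed

text \<open>The Gamma ratio \<open>r\<close> lies between \<open>a / 2\<close> and
  \<open>b / 2\<close>, and \<open>b - a \<le> 1 / a\<close>. Since
  \<open>real n + 1 = b * b / 2\<close>, the bound is \<open>2 * r + r / (real n + 1)\<close> for
  odd \<open>n\<close> and \<open>b * b / (2 * r)\<close> for even \<open>n\<close>, both close to
  \<open>b\<close>.\<close>

lemma density_bound_asymp:
  assumes n: "n > 0"
  shows "\<bar>density_bound n - sqrt (2 * real n + 2)\<bar> \<le> 2 / sqrt (real n)"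
proof -
  define a where "a = sqrt (2 * real n)"
  define b where "b = sqrt (2 * real n + 2)"
  define r where "r = Gamma (real n / 2 + 1) / Gamma ((real n + 1) / 2)"
  have ab: "0 < a" "a \<le> b" using n by (auto simp: a_def b_def)
  have a2: "a * a = 2 * real n" and b2: "b * b = 2 * real n + 2" by (auto simp: a_def b_def)
  have sq: "sqrt (real n / 2) = a / 2" "sqrt (real n / 2 + 1 / 2) = b / 2"
    using a2 b2 ab by (intro real_sqrt_unique; simp add: power2_eq_square)+
  have hn: "real n / 2 + 1/2 = (real n + 1) / 2" by simp
  have ra: "a / 2 \<le> r" and rb: "r \<le> b / 2"
    using Gamma_ratio_bounds[of "real n / 2"] n unfolding sq unfolding hn r_def by auto
  have r0: "r > 0" using ra ab by linarith
  have diff: "b - a \<le> 1 / a"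
  proof -
    have "(b - a) * (a + b) = 2" using a2 b2 by (simp add: algebra_simps)
    moreover have "(b - a) * (2 * a) \<le> (b - a) * (a + b)" using ab by (intro mult_left_mono) auto
    ultimately show ?thesis using ab by (simp add: field_simps)
  qed
  have "\<bar>density_bound n - b\<bar> \<le> 2 / a"
  proof (cases "odd n")
    case True
    have np: "real n + 1 = b * b / 2" using b2 by simp
    have "density_bound n = (2 * real n + 3) / (real n + 1) * r" using True by (simp add: density_bound_def r_def)
    also have "(2 * real n + 3) / (real n + 1) = 2 + 1 / (real n + 1)" by (simp add: field_simps)
    finally have D: "density_bound n = 2 * r + r / (real n + 1)" by (simp add: algebra_simps)
    have "r / (real n + 1) \<le> 1 / b"
      unfolding np using rb ab r0 by (simp add: field_simps)
    moreover have "1 / b \<le> 1 / a" using ab by (simp add: frac_le)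
    moreover have "r / (real n + 1) \<ge> 0" using r0 by simp
    moreover have "1 / a > 0" using ab by simp
    moreover have "2 / a = 2 * (1 / a)" by simp
    ultimately show ?thesis using D ra rb diff by linarith
  next
    case False
    have D: "density_bound n = (real n + 1) / r" using False by (simp add: density_bound_def r_def)
    have "b \<le> density_bound n" unfolding D using rb r0 ab b2 mult_left_mono[OF rb, of b] by (simp add: field_simps)
    moreover have "density_bound n \<le> b + 2 / a"
    proof -
      have "density_bound n \<le> (real n + 1) / (a / 2)" unfolding D using ra ab by (intro divide_left_mono) auto
      also have "\<dots> = b * b / a" using b2 by (simp add: field_simps)
      also have "\<dots> = b + b * (b - a) / a" using ab by (simp add: field_simps)
      also have "b * (b - a) \<le> 2"
      proof -
        have "(b - a) * (a + b) = 2" using a2 b2 by (simp add: algebra_simps)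
        moreover have "(b - a) * b \<le> (b - a) * (a + b)" using ab by (intro mult_left_mono) auto
        ultimately show ?thesis by (simp add: mult.commute)
      qed
      finally show ?thesis using ab by (simp add: divide_right_mono)
    qed
    ultimately show ?thesis by simp
  qed
  also have "2 / a \<le> 2 / sqrt (real n)" using n by (intro divide_left_mono) (auto simp: a_def)
  finally show ?thesis by (simp add: b_def)
qed

text \<open>Subtracting \<open>2 * sqrt (m + 1)\<close> gives an increasing sequence, subtracting
  \<open>2 * sqrt m\<close> a decreasing one, and their gap tends to 0. The common limit
  \<open>z\<close> lies between them, so the gap bounds the error. Classically \<open>z\<close> is
  zeta(1/2).\<close>

lemma inverse_sqrt_sum_asymp:
  obtains z where "\<And>m. m > 0 \<Longrightarrow> \<bar>(\<Sum>k<m. 1 / sqrt (real k + 1)) - 2 * sqrt (real m) - z\<bar> \<le> 1 / sqrt (real m)"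
proof -
  define H where "H m = (\<Sum>k<m. 1 / sqrt (real k + 1))" for m
  define f where "f m = H m - 2 * sqrt (real m + 1)" for m
  define g where "g m = H m - 2 * sqrt (real m)" for m
  have step: "1 / sqrt (x + 1) \<le> 2 * (sqrt (x + 1) - sqrt x)" "x > 0 \<Longrightarrow> 2 * (sqrt (x + 1) - sqrt x) \<le> 1 / sqrt x" if "x \<ge> 0" for x :: real
  proof -
    define a where "a = sqrt x" define b where "b = sqrt (x + 1)"
    have ab: "0 \<le> a" "a < b" "(b - a) * (a + b) = 1" using that by (auto simp: a_def b_def algebra_simps)
    have "1 \<le> 2 * (b - a) * b" using mult_left_mono[of "a + b" "2 * b" "b - a"] ab by (simp add: algebra_simps)
    then show "1 / sqrt (x + 1) \<le> 2 * (sqrt (x + 1) - sqrt x)"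
      using ab unfolding a_def[symmetric] b_def[symmetric] by (simp add: field_simps)
    have "2 * (b - a) * a \<le> 1" using mult_left_mono[of "2 * a" "a + b" "b - a"] ab by (simp add: algebra_simps)
    then show "2 * (sqrt (x + 1) - sqrt x) \<le> 1 / sqrt x" if "x > 0"
      using ab that unfolding a_def[symmetric] b_def[symmetric] by (simp add: field_simps a_def)
  qed
  have "\<exists>l. ((\<forall>n. f n \<le> l) \<and> f \<longlonglongrightarrow> l) \<and> ((\<forall>n. l \<le> g n) \<and> g \<longlonglongrightarrow> l)"
  proof (rule nested_sequence_unique)
    show "\<forall>n. f n \<le> f (Suc n)"
    proof
      fix n show "f n \<le> f (Suc n)" using step(2)[of "real n + 1"] by (simp add: f_def H_def add_ac)
    qed
    show "\<forall>n. g (Suc n) \<le> g n"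
    proof
      fix n show "g (Suc n) \<le> g n" using step(1)[of "real n"] by (simp add: g_def H_def add_ac)
    qed
    show "\<forall>n. f n \<le> g n" by (simp add: f_def g_def)
    have "(\<lambda>n. f n - g n) = (\<lambda>n. 2 * sqrt (real n) - 2 * sqrt (real n + 1))" by (simp add: f_def g_def fun_eq_iff)
    moreover have "(\<lambda>n. 2 * sqrt (real n) - 2 * sqrt (real n + 1)) \<longlonglongrightarrow> 0" by real_asymp
    ultimately show "(\<lambda>n. f n - g n) \<longlonglongrightarrow> 0" by simp
  qed
  then obtain z where z: "\<And>n. f n \<le> z" "\<And>n. z \<le> g n" by blast
  show ?thesis
  proof (rule that[of z])
    fix m :: nat assume m: "m > 0"
    then show "\<bar>(\<Sum>k<m. 1 / sqrt (real k + 1)) - 2 * sqrt (real m) - z\<bar> \<le> 1 / sqrt (real m)"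
      using z[of m] step(2)[of "real m"] unfolding f_def g_def H_def by (simp add: abs_le_iff)
  qed
qed

text \<open>The odd terms are half of the full sum up to \<open>2m\<close> plus the alternating sum,
  which leads to \<open>U m = e (2 * m) + H m / sqrt 2\<close>. The first part converges to eta(1/2)
  at Leibniz speed, the second is covered by the preceding lemma.\<close>

lemma odd_inverse_sqrt_sum_asymp:
  assumes m: "m > 0"
  shows "\<bar>(\<Sum>k<m. 1 / sqrt (2 * real k + 1)) - sqrt (2 * real m) - Z0 (1/2)\<bar> \<le> 2 / sqrt (real m)"
proof -
  define H where "H m = (\<Sum>k<m. 1 / sqrt (real k + 1))" for m
  define U where "U m = (\<Sum>k<m. 1 / sqrt (2 * real k + 1))" for m
  define a where "a k = 1 / sqrt (real k + 1)" for k
  define e where "e m = (\<Sum>k<m. (- 1) ^ k * a k)" for m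
  define \<eta> where "\<eta> = (\<Sum>k. (- 1) ^ k * a k)"
  obtain z where z: "\<And>m. m > 0 \<Longrightarrow> \<bar>H m - 2 * sqrt (real m) - z\<bar> \<le> 1 / sqrt (real m)"
    unfolding H_def using inverse_sqrt_sum_asymp by blast
  have eH: "e (2 * m) = U m - H m / sqrt 2" and HH: "H (2 * m) = U m + H m / sqrt 2" for m
  proof -
    have s: "sqrt (2 + 2 * real m) = sqrt 2 * sqrt (1 + real m)" for m
      by (simp add: real_sqrt_mult[symmetric] algebra_simps)
    show "e (2 * m) = U m - H m / sqrt 2"
      by (induction m) (auto simp: e_def U_def H_def a_def s add_divide_distrib add_ac)
    show "H (2 * m) = U m + H m / sqrt 2"
      by (induction m) (auto simp: U_def H_def s add_divide_distrib add_ac)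
  qed
  have a0: "a \<longlonglongrightarrow> 0" unfolding a_def by real_asymp
  have ap: "a n \<ge> 0" "a (Suc n) \<le> a n" for n by (auto simp: a_def intro!: divide_left_mono)
  note L = summable_Leibniz'[OF a0 ap]
  have e_err: "\<bar>e (2 * m) - \<eta>\<bar> \<le> 1 / sqrt (2 * real m + 1)" for m
    using L(2)[of m] L(4)[of m] by (simp add: e_def \<eta>_def a_def)
  have Hlim: "(\<lambda>m. H m - 2 * sqrt (real m)) \<longlonglongrightarrow> z"
  proof (rule LIM_zero_cancel, rule Lim_null_comparison)
    show "\<forall>\<^sub>F m in sequentially. norm (H m - 2 * sqrt (real m) - z) \<le> 1 / sqrt (real m)"
      using eventually_gt_at_top[of 0] by eventually_elim (use z in auto)
    show "(\<lambda>m. 1 / sqrt (real m)) \<longlonglongrightarrow> 0" by real_asymp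
  qed
  have Hlim2: "(\<lambda>m. H (2 * m) - 2 * sqrt (real (2 * m))) \<longlonglongrightarrow> z"
    using LIMSEQ_subseq_LIMSEQ[OF Hlim, of "\<lambda>m. 2 * m"] by (simp add: strict_mono_def o_def)
  \<comment> \<open>Comparing the sums at \<open>2m\<close> and \<open>m\<close> cancels the square
    root growth and leaves the alternating sum. The resulting relation
    \<open>\<eta> = (1 - sqrt 2) * z\<close> identifies \<open>z\<close> with
    \<open>riemann_zeta (1/2)\<close>.\<close>
  have "(\<lambda>m. (H (2 * m) - 2 * sqrt (real (2 * m))) - sqrt 2 * (H m - 2 * sqrt (real m))) \<longlonglongrightarrow> z - sqrt 2 * z"
    by (intro tendsto_intros Hlim Hlim2)
  moreover have "(H (2 * m) - 2 * sqrt (real (2 * m))) - sqrt 2 * (H m - 2 * sqrt (real m)) = e (2 * m)" for m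
  proof -
    have "sqrt 2 * H m = 2 * (H m / sqrt 2)" by (simp add: field_simps)
    then show ?thesis unfolding eH HH by (simp add: real_sqrt_mult algebra_simps)
  qed
  ultimately have "(\<lambda>m. e (2 * m)) \<longlonglongrightarrow> z - sqrt 2 * z" by simp
  moreover have "(\<lambda>m. e (2 * m)) \<longlonglongrightarrow> \<eta>" using L(3) by (simp add: e_def \<eta>_def)
  ultimately have \<eta>z: "\<eta> = (1 - sqrt 2) * z" using LIMSEQ_unique by (fastforce simp: algebra_simps)
  have "dirichlet_eta (1/2) = \<eta>"
    by (simp add: dirichlet_eta_def \<eta>_def a_def powr_half_sqrt)
  then have "Z0 (1/2) = (1 - 1 / sqrt 2) * (\<eta> / (1 - sqrt 2))"
    by (simp add: Z0_def riemann_zeta_def powr_minus powr_half_sqrt inverse_eq_divide)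
  also have "\<dots> = (1 - 1 / sqrt 2) * z" unfolding \<eta>z by simp
  also have "\<dots> = \<eta> + z / sqrt 2"
  proof -
    have "sqrt 2 = 2 / sqrt 2" by (simp add: real_div_sqrt)
    then have "(1 - sqrt 2) * z = (1 - 2 / sqrt 2) * z" by metis
    then show ?thesis unfolding \<eta>z by (simp add: algebra_simps)
  qed
  finally have Z: "Z0 (1/2) = \<eta> + z / sqrt 2" .
  have s2m: "sqrt (2 * real m) = 2 * sqrt (real m) / sqrt 2" by (simp add: real_sqrt_mult real_div_sqrt field_simps)
  have "U m - sqrt (2 * real m) - Z0 (1/2) = (e (2 * m) - \<eta>) + (H m - 2 * sqrt (real m) - z) / sqrt 2"
    unfolding Z eH s2m by (simp add: diff_divide_distrib)
  then have "\<bar>U m - sqrt (2 * real m) - Z0 (1/2)\<bar> \<le> \<bar>e (2 * m) - \<eta>\<bar> + \<bar>H m - 2 * sqrt (real m) - z\<bar> / sqrt 2"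
    by (metis abs_triangle_ineq abs_divide abs_of_pos real_sqrt_gt_zero zero_less_numeral)
  also have "\<bar>e (2 * m) - \<eta>\<bar> \<le> 1 / sqrt (real m)"
    by (rule order_trans[OF e_err]) (use m in \<open>auto intro!: divide_left_mono\<close>)
  also have "\<bar>H m - 2 * sqrt (real m) - z\<bar> / sqrt 2 \<le> 1 / sqrt (real m)"
  proof -
    have "\<bar>H m - 2 * sqrt (real m) - z\<bar> / sqrt 2 \<le> \<bar>H m - 2 * sqrt (real m) - z\<bar> / 1"
      by (intro divide_left_mono) auto
    then show ?thesis using z[OF m] by simp
  qed
  finally show ?thesis by (simp add: U_def)
qed

text \<open>Both the Gamma quotient and the sum of \<open>n + 1\<close> terms grow like
  \<open>sqrt (2 * real n + 2)\<close>, which cancels; the constant 4 adds their errors of 2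
  each.\<close>

lemma chi_asymp: "(\<lambda>n. chi n - (- Z0 (1/2))) \<in> O(\<lambda>n. 1 / sqrt (real n))"
proof (rule landau_o.bigI[where c = 4])
  show "\<forall>\<^sub>F n in sequentially. norm (chi n - (- Z0 (1/2))) \<le> 4 * norm (1 / sqrt (real n))"
    using eventually_gt_at_top[of 0]
  proof eventually_elim
    case (elim n)
    have "\<bar>(\<Sum>k\<le>n. 1 / sqrt (lam0 k)) - sqrt (2 * real n + 2) - Z0 (1/2)\<bar> \<le> 2 / sqrt (real (Suc n))"
      using odd_inverse_sqrt_sum_asymp[of "Suc n"] by (simp add: lessThan_Suc_atMost lam0_def algebra_simps)
    also have "\<dots> \<le> 2 / sqrt (real n)" using elim by (intro divide_left_mono) auto
    finally show ?case using density_bound_asymp[OF elim] unfolding chi_eq by simp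
  qed
qed simp

section \<open>Weak solutions tested by hat functions\<close>

text \<open>Written through ramps \<open>max 0 (y - x)\<close>, so that integrating against it gives differences of
  the potential in \<open>ramp_integral\<close>, a second antiderivative of an integrable function.\<close>
definition hat :: "real \<Rightarrow> real \<Rightarrow> real \<Rightarrow> real \<Rightarrow> real" where
  "hat a b c x = max 0 (c - x) / (c - b) - max 0 (b - x) * (1 / (c - b) + 1 / (b - a)) + max 0 (a - x) / (b - a)"

lemma continuous_bounded_Icc:
  fixes f :: "real \<Rightarrow> real"
  assumes "continuous_on {a..b} f"
  obtains K where "\<And>x. x \<in> {a..b} \<Longrightarrow> \<bar>f x\<bar> \<le> K"
proof -
  have "bounded (f ` {a..b})" by (intro compact_imp_bounded compact_continuous_image assms) simp
  then show ?thesis using that by (force simp: bounded_iff)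
qed

text \<open>Right of \<open>c\<close> all ramps vanish. Left of \<open>a\<close> all are active, and
  the combination is a divided second difference of an affine function.\<close>

lemma hat_outside:
  assumes "a < b" "b < c" "x \<notin> {a..c}"
  shows "hat a b c x = 0"
proof (cases "x < a")
  case True
  then have "hat a b c x = (c - x) / (c - b) - (b - x) * (1 / (c - b) + 1 / (b - a)) + (a - x) / (b - a)"
    using assms by (simp add: hat_def)
  also have "\<dots> = 0"
  proof -
    have "((P + y) / P) - y * (1 / P + 1 / W) + (y - W) / W = 0" if "P \<noteq> 0" "W \<noteq> 0" for P W y :: real
      using that by (simp add: field_simps)
    from this[of "c - b" "b - a" "b - x"] show ?thesis using assms by simp
  qed
  finally show ?thesis .
next
  case False
  then show ?thesis using assms by (simp add: hat_def)
qed

lemma continuous_hat [continuous_intros]: "continuous_on S (hat a b c)"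
  unfolding hat_def divide_inverse by (intro continuous_intros)

lemma hat_measurable [measurable]: "hat a b c \<in> borel_measurable borel"
  by (intro borel_measurable_continuous_onI continuous_hat)

lemma integrable_continuous_times_hat:
  assumes "a < b" "b < c" "continuous_on {a..c} f"
  shows "integrable lborel (\<lambda>x. f x * hat a b c x)"
proof -
  have "set_integrable lborel {a..c} (\<lambda>x. f x * hat a b c x)"
    by (intro borel_integrable_atLeastAtMost' continuous_on_mult assms continuous_hat)
  moreover have "indicat_real {a..c} x *\<^sub>R (f x * hat a b c x) = f x * hat a b c x" for x
    using hat_outside[OF assms(1,2), of x] by (auto split: split_indicator)
  ultimately show ?thesis unfolding set_integrable_def by (simp only:)
qed

lemma hat_bounded:
  assumes "a < b" "b < c"
  obtains K where "\<And>x. \<bar>hat a b c x\<bar> \<le> K"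
proof -
  obtain K where K: "\<And>x. x \<in> {a..c} \<Longrightarrow> \<bar>hat a b c x\<bar> \<le> K"
    using continuous_bounded_Icc[OF continuous_hat] by blast
  have "\<bar>hat a b c x\<bar> \<le> max 0 K" for x
    using K[of x] hat_outside[OF assms, of x] by (cases "x \<in> {a..c}") force+
  then show ?thesis by (rule that)
qed

text \<open>The support condition makes the ramp bounded wherever \<open>k\<close> lives. Ramps are
  1-Lipschitz in \<open>y\<close>, so the difference quotients are dominated by
  \<open>\<bar>k x\<bar>\<close>.\<close>

lemma ramp_integral:
  fixes k :: "real \<Rightarrow> real"
  assumes k: "integrable lborel k" and supp: "\<And>x. x < R \<Longrightarrow> k x = 0"
  shows "integrable lborel (\<lambda>x. k x * max 0 (y - x))"
    and "((\<lambda>y. \<integral>x. k x * max 0 (y - x) \<partial>lborel) has_real_derivative (\<integral>x. k x * indicator {..<y} x \<partial>lborel)) (at y)"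
proof -
  have [measurable]: "k \<in> borel_measurable borel" using borel_measurable_integrable[OF k] by simp
  show int: "integrable lborel (\<lambda>x. k x * max 0 (y - x))" for y
  proof (rule Bochner_Integration.integrable_bound[OF integrable_mult_left[OF k, of "\<bar>y - R\<bar>"]])
    show "AE x in lborel. norm (k x * max 0 (y - x)) \<le> norm (k x * \<bar>y - R\<bar>)"
    proof (intro AE_I2)
      fix x
      show "norm (k x * max 0 (y - x)) \<le> norm (k x * \<bar>y - R\<bar>)"
      proof (cases "x < R")
        case False
        then have "\<bar>max 0 (y - x)\<bar> \<le> \<bar>y - R\<bar>" by simp
        then show ?thesis by (simp add: abs_mult mult_left_mono)
      qed (simp add: supp)
    qed
  qed measurable
  define \<Phi> where "\<Phi> y = (\<integral>x. k x * max 0 (y - x) \<partial>lborel)" for y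
  have "((\<lambda>z. (\<Phi> z - \<Phi> y) / (z - y)) \<longlongrightarrow> (\<integral>x. k x * indicator {..<y} x \<partial>lborel)) (at y)"
    unfolding tendsto_at_iff_sequentially comp_def
  proof (intro allI impI)
    fix X :: "nat \<Rightarrow> real" assume X: "\<forall>i. X i \<in> UNIV - {y}" "X \<longlonglongrightarrow> y"
    have eq: "(\<Phi> (X i) - \<Phi> y) / (X i - y) = (\<integral>x. k x * ((max 0 (X i - x) - max 0 (y - x)) / (X i - y)) \<partial>lborel)" for i
      unfolding \<Phi>_def by (simp add: int right_diff_distrib diff_divide_distrib)
    show "(\<lambda>i. (\<Phi> (X i) - \<Phi> y) / (X i - y)) \<longlonglongrightarrow> (\<integral>x. k x * indicator {..<y} x \<partial>lborel)"
      unfolding eq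
    proof (rule integral_dominated_convergence[where w = "\<lambda>x. \<bar>k x\<bar>"])
      \<comment> \<open>Only the kink \<open>x = y\<close> is excluded; at any other
        \<open>x\<close> the quotient is eventually constant, 1 or 0 according to the side.\<close>
      show "AE x in lborel. (\<lambda>i. k x * ((max 0 (X i - x) - max 0 (y - x)) / (X i - y))) \<longlonglongrightarrow> k x * indicator {..<y} x"
        using AE_lborel_singleton[of y]
      proof eventually_elim
        case (elim x)
        have "\<forall>\<^sub>F i in sequentially. dist (X i) y < \<bar>x - y\<bar>"
          using X(2) elim by (intro tendstoD) auto
        then have "\<forall>\<^sub>F i in sequentially. k x * ((max 0 (X i - x) - max 0 (y - x)) / (X i - y)) = k x * indicator {..<y} x"
        proof eventually_elim
          case (elim i)
          have "X i \<noteq> y" using X(1) by auto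
          then show ?case using elim by (cases "x < y") (auto simp: dist_real_def abs_if max_def split: if_splits)
        qed
        then show ?case by (rule tendsto_eventually)
      qed
      show "AE x in lborel. norm (k x * ((max 0 (X i - x) - max 0 (y - x)) / (X i - y))) \<le> \<bar>k x\<bar>" for i
      proof (intro AE_I2)
        fix x
        have "\<bar>max 0 (X i - x) - max 0 (y - x)\<bar> \<le> \<bar>X i - y\<bar>" by (simp add: max_def)
        then have "\<bar>(max 0 (X i - x) - max 0 (y - x)) / (X i - y)\<bar> \<le> 1"
          using X(1) by (simp add: abs_divide divide_le_eq_1)
        then show "norm (k x * ((max 0 (X i - x) - max 0 (y - x)) / (X i - y))) \<le> \<bar>k x\<bar>"
          unfolding real_norm_def abs_mult by (intro mult_right_le_one_le) auto
      qed
    qed (use k in auto)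
  qed
  then show "((\<lambda>y. \<integral>x. k x * max 0 (y - x) \<partial>lborel) has_real_derivative (\<integral>x. k x * indicator {..<y} x \<partial>lborel)) (at y)"
    unfolding has_field_derivative_iff \<Phi>_def .
qed

text \<open>On a window the hat identity says that \<open>u\<close> minus a second antiderivative of
  \<open>h\<close> has equal difference quotients, hence is affine. So \<open>u\<close> inherits the
  regularity of that antiderivative, and the equation can be read off from
  \<open>deriv u\<close>.\<close>

lemma L2_solution_weakI:
  assumes q: "integrable lborel q" and u: "continuous_on UNIV u"
    and u2: "integrable lborel (\<lambda>x. (u x)\<^sup>2)"
    and weak: "\<And>a b c. a < b \<Longrightarrow> b < c \<Longrightarrow>
      (u b - u a) / (b - a) - (u c - u b) / (c - b) + (\<integral>x. (x\<^sup>2 + q x - mu) * u x * hat a b c x \<partial>lborel) = 0"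
  shows "L2_solution q mu u"
proof -
  define h where "h x = (x\<^sup>2 + q x - mu) * u x" for x
  have [measurable]: "u \<in> borel_measurable borel" using u by (rule borel_measurable_continuous_onI)
  have [measurable]: "q \<in> borel_measurable borel" using borel_measurable_integrable[OF q] by simp
  have hm [measurable]: "h \<in> borel_measurable borel" unfolding h_def by measurable
  have h_int: "set_integrable lborel {a..b} h" for a b
  proof -
    have 1: "set_integrable lborel {a..b} (\<lambda>x. (x\<^sup>2 - mu) * u x)"
      by (intro borel_integrable_atLeastAtMost' continuous_intros continuous_on_subset[OF u]) auto
    obtain K where K: "\<And>x. x \<in> {a..b} \<Longrightarrow> \<bar>u x\<bar> \<le> K"
      using continuous_bounded_Icc[OF continuous_on_subset[OF u]] by blast
    have 2: "set_integrable lborel {a..b} (\<lambda>x. q x * u x)"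
      unfolding set_integrable_def
    proof (rule Bochner_Integration.integrable_bound[OF integrable_mult_left[OF q, of K]])
      show "AE x in lborel. norm (indicat_real {a..b} x *\<^sub>R (q x * u x)) \<le> norm (q x * K)"
        using K by (intro AE_I2) (force simp: abs_mult split: split_indicator intro!: mult_left_mono)
    qed measurable
    have "set_integrable lborel {a..b} (\<lambda>x. (x\<^sup>2 - mu) * u x + q x * u x)"
      by (rule set_integral_add(1)[OF 1 2])
    moreover have "(\<lambda>x. (x\<^sup>2 - mu) * u x + q x * u x) = h" by (auto simp: h_def algebra_simps)
    ultimately show ?thesis by simp
  qed

  \<comment> \<open>\<open>h\<close> is only locally integrable, so it is cut off to
    \<open>{R..S}\<close>. The slope \<open>\<kappa>\<close> of the affine part depends on the
    window.\<close>
  have local_sol: "\<exists>\<kappa>. \<forall>y\<in>{R<..<S}. (u has_real_derivative (\<integral>x. indicator {R..S} x * h x * indicator {..<y} x \<partial>lborel) + \<kappa>) (at y)"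
    if RS: "R < S" for R S
  proof -
    define k where "k x = indicator {R..S} x * h x" for x
    have k: "integrable lborel k" using h_int[of R S] by (simp add: k_def[abs_def] set_integrable_def)
    have k0: "k x = 0" if "x < R" for x using that by (simp add: k_def)
    note ramp = ramp_integral[OF k k0]
    define \<Phi> where "\<Phi> y = (\<integral>x. k x * max 0 (y - x) \<partial>lborel)" for y
    \<comment> \<open>Integrating against the hat gives minus the same combination of difference
      quotients for \<open>\<Phi>\<close> that the weak equation contains for
      \<open>u\<close>.\<close>
    have id: "(u b - u a) / (b - a) - (u c - u b) / (c - b) + (\<Phi> c / (c - b) - \<Phi> b * (1 / (c - b) + 1 / (b - a)) + \<Phi> a / (b - a)) = 0"
      if abc: "R \<le> a" "a < b" "b < c" "c \<le> S" for a b c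
    proof -
      have "(\<integral>x. h x * hat a b c x \<partial>lborel) = (\<integral>x. (k x * max 0 (c - x)) / (c - b) - (k x * max 0 (b - x)) * (1 / (c - b) + 1 / (b - a)) + (k x * max 0 (a - x)) / (b - a) \<partial>lborel)"
      proof (intro Bochner_Integration.integral_cong refl)
        fix x
        have "h x * hat a b c x = k x * hat a b c x"
          using hat_outside[OF abc(2,3), of x] abc by (cases "x \<in> {a..c}") (auto simp: k_def)
        then show "h x * hat a b c x = (k x * max 0 (c - x)) / (c - b) - (k x * max 0 (b - x)) * (1 / (c - b) + 1 / (b - a)) + (k x * max 0 (a - x)) / (b - a)"
          by (simp add: hat_def ring_distribs)
      qed
      also have "\<dots> = \<Phi> c / (c - b) - \<Phi> b * (1 / (c - b) + 1 / (b - a)) + \<Phi> a / (b - a)"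
        unfolding \<Phi>_def using ramp(1)
        by (subst Bochner_Integration.integral_add, simp, simp, subst Bochner_Integration.integral_diff, simp, simp, simp)
      finally show ?thesis using weak[OF abc(2,3)] by (simp add: h_def)
    qed
    define v where "v x = u x - \<Phi> x" for x
    define \<kappa> where "\<kappa> = (v S - v R) / (S - R)"
    have aff: "u x = \<Phi> x + (v R + \<kappa> * (x - R))" if x: "x \<in> {R<..<S}" for x
    proof -
      have "(u x - u R) / (x - R) - (u S - u x) / (S - x) + (\<Phi> S / (S - x) - \<Phi> x * (1 / (S - x) + 1 / (x - R)) + \<Phi> R / (x - R)) = 0"
        using id[of R x S] x by auto
      moreover have "(u x - u R) / (x - R) - (u S - u x) / (S - x) + (\<Phi> S / (S - x) - \<Phi> x * (1 / (S - x) + 1 / (x - R)) + \<Phi> R / (x - R))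
         = (v x - v R) / (x - R) - (v S - v x) / (S - x)"
        by (simp add: v_def diff_divide_distrib ring_distribs)
      ultimately have "(v x - v R) / (x - R) = (v S - v x) / (S - x)" by simp
      then have "(v x - v R) * (S - x) = (v S - v x) * (x - R)" using x by (simp add: frac_eq_eq)
      then have "(v x - v R) * (S - R) = (v S - v R) * (x - R)" by (simp add: algebra_simps)
      then have "v x - v R = \<kappa> * (x - R)" using RS by (simp add: \<kappa>_def field_simps)
      then show ?thesis by (simp add: v_def)
    qed
    show ?thesis
    proof (intro exI ballI)
      fix y assume y: "y \<in> {R<..<S}"
      have "((\<lambda>x. \<Phi> x + (v R + \<kappa> * (x - R))) has_real_derivative (\<integral>x. k x * indicator {..<y} x \<partial>lborel) + \<kappa>) (at y)"
        unfolding \<Phi>_def by (auto intro!: derivative_eq_intros ramp(2))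
      then show "(u has_real_derivative (\<integral>x. indicator {R..S} x * h x * indicator {..<y} x \<partial>lborel) + \<kappa>) (at y)"
        unfolding k_def
        by (rule has_field_derivative_transform_within_open[where S = "{R<..<S}"]) (use y aff in \<open>auto simp: k_def\<close>)
    qed
  qed

  have du: "(u has_real_derivative deriv u y) (at y)" for y
  proof -
    have "\<exists>d. (u has_real_derivative d) (at y)" using local_sol[of "y - 1" "y + 1"] by force
    then show ?thesis using DERIV_imp_deriv by blast
  qed
  have inc: "deriv u b - deriv u a = (LBINT x:{a..b}. h x)" if ab: "a \<le> b" for a b
  proof -
    \<comment> \<open>One window containing both endpoints in its interior: the same
      \<open>\<kappa>\<close> serves for both and cancels in the increment.\<close>
    define R where "R = a - 1" define S where "S = b + 1"
    have "R < S" using ab by (simp add: R_def S_def)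
    then obtain \<kappa> where \<kappa>: "\<And>y. y \<in> {R<..<S} \<Longrightarrow> (u has_real_derivative (\<integral>x. indicator {R..S} x * h x * indicator {..<y} x \<partial>lborel) + \<kappa>) (at y)"
      using local_sol by blast
    have k: "integrable lborel (\<lambda>x. indicator {R..S} x * h x)" using h_int[of R S] by (simp add: set_integrable_def)
    have ki: "integrable lborel (\<lambda>x. indicator {R..S} x * h x * indicator {..<y} x)" for y
      by (rule integrable_real_mult_indicator[OF _ k]) auto
    have "deriv u b - deriv u a = (\<integral>x. indicator {R..S} x * h x * indicator {..<b} x \<partial>lborel) - (\<integral>x. indicator {R..S} x * h x * indicator {..<a} x \<partial>lborel)"
      using DERIV_imp_deriv[OF \<kappa>[of a]] DERIV_imp_deriv[OF \<kappa>[of b]] ab by (simp add: R_def S_def)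
    also have "\<dots> = (\<integral>x. indicator {R..S} x * h x * indicator {..<b} x - indicator {R..S} x * h x * indicator {..<a} x \<partial>lborel)"
      by (rule Bochner_Integration.integral_diff[symmetric]) (rule ki)+
    also have "\<dots> = (\<integral>x. indicator {a..b} x * h x \<partial>lborel)"
    proof (rule integral_cong_AE)
      \<comment> \<open>The difference of the two half-lines is \<open>{a..<b}\<close>, which misses
        \<open>b\<close>.\<close>
      show "AE x in lborel. indicator {R..S} x * h x * indicator {..<b} x - indicator {R..S} x * h x * indicator {..<a} x = indicator {a..b} x * h x"
        using AE_lborel_singleton[of b]
        by eventually_elim (use ab in \<open>auto simp: R_def S_def split: split_indicator\<close>)
    qed measurable
    finally show ?thesis by (simp add: set_lebesgue_integral_def)
  qed
  show ?thesis
    unfolding L2_solution_def h_def[symmetric]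
  proof (intro conjI exI allI impI)
    show "u \<in> borel_measurable lborel" by simp
    show "integrable lborel (\<lambda>x. (u x)\<^sup>2)" by fact
    show "(u has_real_derivative deriv u x) (at x)" for x by (rule du)
    fix a b :: real assume ab: "a \<le> b"
    show "h absolutely_integrable_on {a..b}"
      using h_int[of a b] unfolding set_integrable_def by (subst integrable_completion) auto
    show "(h has_integral deriv u b - deriv u a) {a..b}"
      unfolding inc[OF ab] set_borel_integral_eq_integral(2)[OF h_int]
      by (intro integrable_integral set_borel_integral_eq_integral(1) h_int)
  qed
qed

section \<open>The form domain\<close>

lemma integrable_mult_L2:
  fixes f g :: "real \<Rightarrow> real"
  assumes [measurable]: "f \<in> borel_measurable borel" "g \<in> borel_measurable borel"
    and "integrable lborel (\<lambda>x. (f x)\<^sup>2)" "integrable lborel (\<lambda>x. (g x)\<^sup>2)"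
  shows "integrable lborel (\<lambda>x. f x * g x)"
proof (rule Bochner_Integration.integrable_bound)
  show "integrable lborel (\<lambda>x. (f x)\<^sup>2 + (g x)\<^sup>2)" using assms by auto
  show "AE x in lborel. norm (f x * g x) \<le> norm ((f x)\<^sup>2 + (g x)\<^sup>2)"
  proof (intro AE_I2)
    fix x
    have "\<bar>f x * g x\<bar> \<le> (f x)\<^sup>2 + (g x)\<^sup>2"
      using sum_squares_bound[of "\<bar>f x\<bar>" "\<bar>g x\<bar>"] abs_ge_zero[of "f x * g x"] unfolding abs_mult power2_abs by linarith
    then show "norm (f x * g x) \<le> norm ((f x)\<^sup>2 + (g x)\<^sup>2)" by simp
  qed
qed measurable

text \<open>Elements are pairs of a function and its weak derivative.\<close>
definition form_dom :: "((real \<Rightarrow> real) \<times> (real \<Rightarrow> real)) set" where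
  "form_dom = {(f, f'). f' \<in> borel_measurable borel \<and> integrable lborel (\<lambda>x. (f' x)\<^sup>2) \<and>
     integrable lborel (\<lambda>x. (f x)\<^sup>2) \<and> integrable lborel (\<lambda>x. x\<^sup>2 * (f x)\<^sup>2) \<and>
     (\<forall>a b. a \<le> b \<longrightarrow> f b - f a = (LBINT x:{a..b}. f' x))}"

lemma form_domD:
  assumes "F \<in> form_dom"
  shows "snd F \<in> borel_measurable borel" "integrable lborel (\<lambda>x. (snd F x)\<^sup>2)"
    "integrable lborel (\<lambda>x. (fst F x)\<^sup>2)" "integrable lborel (\<lambda>x. x\<^sup>2 * (fst F x)\<^sup>2)"
    "\<And>a b. a \<le> b \<Longrightarrow> fst F b - fst F a = (LBINT x:{a..b}. snd F x)"
  using assms by (auto simp: form_dom_def)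

lemma integrable_indicator_Icc: "integrable lborel (indicat_real {a..b})" for a b :: real
  using borel_integrable_atLeastAtMost'[of a b "\<lambda>_. 1 :: real"] by (simp add: set_integrable_def)

lemma L2_imp_set_integrable:
  fixes g :: "real \<Rightarrow> real"
  assumes [measurable]: "g \<in> borel_measurable borel" and "integrable lborel (\<lambda>x. (g x)\<^sup>2)"
  shows "set_integrable lborel {a..b} g"
proof -
  have sq: "(\<lambda>x. (indicat_real {a..b} x)\<^sup>2) = indicat_real {a..b}" by (auto split: split_indicator)
  have "integrable lborel (indicat_real {a..b})" by (rule integrable_indicator_Icc)
  then have "integrable lborel (\<lambda>x. indicator {a..b} x * g x)"
    by (intro integrable_mult_L2) (use assms sq in auto)
  then show ?thesis by (simp add: set_integrable_def)
qed

text \<open>Cauchy-Schwarz, obtained by expanding the square of the weak derivative minus its mean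
  \<open>s\<close> over \<open>{a..b}\<close>.\<close>

lemma form_dom_holder:
  assumes F: "F \<in> form_dom" and ab: "a \<le> b"
  shows "(fst F b - fst F a)\<^sup>2 \<le> (b - a) * (\<integral>x. (snd F x)\<^sup>2 \<partial>lborel)"
proof (cases "a = b")
  case False
  then have ab: "a < b" using ab by simp
  note D = form_domD[OF F]
  note [measurable] = D(1)
  define d where "d = fst F b - fst F a"
  define s where "s = d / (b - a)"
  have i1: "set_integrable lborel {a..b} (snd F)" by (rule L2_imp_set_integrable[OF D(1,2)])
  have i2: "integrable lborel (\<lambda>x. indicator {a..b} x * (snd F x)\<^sup>2)"
    using integrable_real_mult_indicator[OF _ D(2), of "{a..b}"] by (simp add: mult.commute)
  have d_eq: "(\<integral>x. indicator {a..b} x * snd F x \<partial>lborel) = d"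
    using D(5)[of a b] ab by (simp add: d_def set_lebesgue_integral_def)
  have "0 \<le> (\<integral>x. indicator {a..b} x * (snd F x - s)\<^sup>2 \<partial>lborel)" by (intro integral_nonneg_AE AE_I2) auto
  also have "\<dots> = (\<integral>x. indicator {a..b} x * (snd F x)\<^sup>2 - 2 * s * (indicator {a..b} x * snd F x) + s\<^sup>2 * indicator {a..b} x \<partial>lborel)"
    by (intro Bochner_Integration.integral_cong) (auto simp: power2_eq_square algebra_simps)
  also have "\<dots> = (\<integral>x. indicator {a..b} x * (snd F x)\<^sup>2 \<partial>lborel) - 2 * s * d + s\<^sup>2 * (b - a)"
    using i1 i2 ab d_eq by (simp add: set_integrable_def)
  also have "(\<integral>x. indicator {a..b} x * (snd F x)\<^sup>2 \<partial>lborel) \<le> (\<integral>x. (snd F x)\<^sup>2 \<partial>lborel)"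
    by (rule integral_mono[OF i2 D(2)]) (auto split: split_indicator)
  finally have "0 \<le> (\<integral>x. (snd F x)\<^sup>2 \<partial>lborel) - 2 * s * d + s\<^sup>2 * (b - a)" by simp
  moreover have "2 * s * d - s\<^sup>2 * (b - a) = d\<^sup>2 / (b - a)"
  proof -
    have "2 * (d / p) * d - (d / p)\<^sup>2 * p = d\<^sup>2 / p" if "p > 0" for p
      using that by (simp add: power2_eq_square)
    then show ?thesis using ab by (simp add: s_def)
  qed
  ultimately have "d\<^sup>2 / (b - a) \<le> (\<integral>x. (snd F x)\<^sup>2 \<partial>lborel)" by linarith
  then show ?thesis using ab by (simp add: d_def pos_divide_le_eq mult.commute)
qed simp

lemma form_dom_holder_abs:
  assumes F: "F \<in> form_dom"
  shows "(fst F x - fst F y)\<^sup>2 \<le> \<bar>x - y\<bar> * (\<integral>x. (snd F x)\<^sup>2 \<partial>lborel)"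
  using form_dom_holder[OF F, of x y] form_dom_holder[OF F, of y x]
  by (cases "x \<le> y") (auto simp: power2_commute[of "fst F x"])

lemma holder_continuous:
  fixes f :: "real \<Rightarrow> real"
  assumes "\<And>x y. (f x - f y)\<^sup>2 \<le> \<bar>x - y\<bar> * K"
  shows "continuous_on UNIV f"
proof -
  have "isCont f x" for x
    unfolding isCont_def
  proof (rule LIM_zero_cancel, rule Lim_null_comparison)
    show "\<forall>\<^sub>F y in at x. norm (f y - f x) \<le> sqrt (\<bar>y - x\<bar> * K)"
      using real_sqrt_le_mono[OF assms[of _ x]] by (intro always_eventually) simp
    have "((\<lambda>y. sqrt (\<bar>y - x\<bar> * K)) \<longlongrightarrow> sqrt (\<bar>x - x\<bar> * K)) (at x)"
      by (intro tendsto_intros)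
    then show "((\<lambda>y. sqrt (\<bar>y - x\<bar> * K)) \<longlongrightarrow> 0) (at x)" by simp
  qed
  then show ?thesis by (simp add: continuous_at_imp_continuous_on)
qed

lemma form_dom_continuous: "F \<in> form_dom \<Longrightarrow> continuous_on UNIV (fst F)"
  by (rule holder_continuous[OF form_dom_holder_abs])

lemma form_dom_measurable: "F \<in> form_dom \<Longrightarrow> fst F \<in> borel_measurable borel"
  by (intro borel_measurable_continuous_onI form_dom_continuous)

text \<open>Compare the value at \<open>x\<close> with the values at \<open>y \<in> {x..x+1}\<close>
  by the Hoelder bound and average over \<open>y\<close>.\<close>

lemma form_dom_bounded:
  assumes F: "F \<in> form_dom"
  shows "(fst F x)\<^sup>2 \<le> 2 * (\<integral>x. (fst F x)\<^sup>2 \<partial>lborel) + 2 * (\<integral>x. (snd F x)\<^sup>2 \<partial>lborel)"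
proof -
  note D = form_domD[OF F]
  define I where "I = (\<integral>x. (snd F x)\<^sup>2 \<partial>lborel)"
  have I0: "I \<ge> 0" by (simp add: I_def)
  have le: "(fst F x)\<^sup>2 \<le> 2 * (fst F y)\<^sup>2 + 2 * I" if "y \<in> {x..x+1}" for y
  proof -
    have "(fst F x - fst F y)\<^sup>2 \<le> \<bar>x - y\<bar> * I" using form_dom_holder_abs[OF F] by (simp add: I_def)
    also have "\<dots> \<le> 1 * I" using that I0 by (intro mult_right_mono) auto
    finally have 1: "(fst F x - fst F y)\<^sup>2 \<le> I" by simp
    have "(fst F x)\<^sup>2 \<le> 2 * (fst F y)\<^sup>2 + 2 * (fst F x - fst F y)\<^sup>2"
      using zero_le_power2[of "fst F x - 2 * fst F y"] by (simp add: power2_eq_square algebra_simps)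
    then show ?thesis using 1 by simp
  qed
  have i: "integrable lborel (\<lambda>y. indicator {x..x+1} y * (fst F y)\<^sup>2)"
    using integrable_real_mult_indicator[OF _ D(3), of "{x..x+1}"] by (simp add: mult.commute)
  have "(fst F x)\<^sup>2 = (\<integral>y. indicator {x..x+1} y * (fst F x)\<^sup>2 \<partial>lborel)" by simp
  also have "\<dots> \<le> (\<integral>y. 2 * (indicator {x..x+1} y * (fst F y)\<^sup>2) + indicator {x..x+1} y * (2 * I) \<partial>lborel)"
    by (rule integral_mono) (use i le in \<open>auto split: split_indicator\<close>)
  also have "\<dots> = 2 * (\<integral>y. indicator {x..x+1} y * (fst F y)\<^sup>2 \<partial>lborel) + 2 * I" using i by simp
  also have "(\<integral>y. indicator {x..x+1} y * (fst F y)\<^sup>2 \<partial>lborel) \<le> (\<integral>y. (fst F y)\<^sup>2 \<partial>lborel)"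
    by (rule integral_mono[OF i D(3)]) (auto split: split_indicator)
  finally show ?thesis by (simp add: I_def)
qed

definition form_comb :: "real \<Rightarrow> (real \<Rightarrow> real) \<times> (real \<Rightarrow> real) \<Rightarrow> real \<Rightarrow> (real \<Rightarrow> real) \<times> (real \<Rightarrow> real) \<Rightarrow> (real \<Rightarrow> real) \<times> (real \<Rightarrow> real)" where
  "form_comb a F b G = (\<lambda>x. a * fst F x + b * fst G x, \<lambda>x. a * snd F x + b * snd G x)"

definition form_inner :: "(real \<Rightarrow> real) \<times> (real \<Rightarrow> real) \<Rightarrow> (real \<Rightarrow> real) \<times> (real \<Rightarrow> real) \<Rightarrow> real" where
  "form_inner F G = (\<integral>x. fst F x * fst G x \<partial>lborel)"

definition form_energy :: "(real \<Rightarrow> real) \<Rightarrow> (real \<Rightarrow> real) \<times> (real \<Rightarrow> real) \<Rightarrow> (real \<Rightarrow> real) \<times> (real \<Rightarrow> real) \<Rightarrow> real" where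
  "form_energy q F G = (\<integral>x. snd F x * snd G x + (x\<^sup>2 + q x) * (fst F x * fst G x) \<partial>lborel)"

lemma form_dom_inner_integrable:
  assumes "F \<in> form_dom" "G \<in> form_dom"
  shows "integrable lborel (\<lambda>x. fst F x * fst G x)"
  using assms by (intro integrable_mult_L2 form_dom_measurable form_domD(3))

lemma form_dom_deriv_integrable:
  assumes "F \<in> form_dom" "G \<in> form_dom"
  shows "integrable lborel (\<lambda>x. snd F x * snd G x)"
  using assms by (intro integrable_mult_L2 form_domD(1,2))

lemma form_dom_x2_integrable:
  assumes "F \<in> form_dom" "G \<in> form_dom"
  shows "integrable lborel (\<lambda>x. x\<^sup>2 * (fst F x * fst G x))"
proof -
  note [measurable] = form_dom_measurable[OF assms(1)] form_dom_measurable[OF assms(2)]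
  have "integrable lborel (\<lambda>x. (x * fst F x) * (x * fst G x))"
    using form_domD(4)[OF assms(1)] form_domD(4)[OF assms(2)]
    by (intro integrable_mult_L2) (auto simp: power_mult_distrib)
  then show ?thesis by (simp add: power2_eq_square mult_ac)
qed

lemma form_dom_abs_bounded:
  assumes "F \<in> form_dom"
  obtains K where "\<And>x. \<bar>fst F x\<bar> \<le> K"
  using real_sqrt_le_mono[OF form_dom_bounded[OF assms]] by fastforce

text \<open>Boundedness of the members of the form domain is what lets a merely integrable potential
  enter the energy.\<close>

lemma form_dom_potential_integrable:
  assumes q: "integrable lborel q" and F: "F \<in> form_dom" "G \<in> form_dom"
  shows "integrable lborel (\<lambda>x. q x * (fst F x * fst G x))"
proof -
  have [measurable]: "q \<in> borel_measurable borel" using borel_measurable_integrable[OF q] by simp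
  note [measurable] = form_dom_measurable[OF F(1)] form_dom_measurable[OF F(2)]
  obtain K L where K: "\<And>x. \<bar>fst F x\<bar> \<le> K" and L: "\<And>x. \<bar>fst G x\<bar> \<le> L"
    using form_dom_abs_bounded F by metis
  show ?thesis
  proof (rule Bochner_Integration.integrable_bound[OF integrable_mult_left[OF q, of "K * L"]])
    show "AE x in lborel. norm (q x * (fst F x * fst G x)) \<le> norm (q x * (K * L))"
    proof (intro AE_I2)
      fix x
      have "\<bar>fst F x * fst G x\<bar> \<le> K * L"
        unfolding abs_mult using K[of x] L[of x] by (intro mult_mono) auto
      then have "\<bar>fst F x * fst G x\<bar> \<le> \<bar>K * L\<bar>" by simp
      then show "norm (q x * (fst F x * fst G x)) \<le> norm (q x * (K * L))"
        unfolding real_norm_def abs_mult[of "q x"] by (intro mult_left_mono) auto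
    qed
  qed measurable
qed

lemma form_energy_integrable:
  assumes q: "integrable lborel q" and F: "F \<in> form_dom" "G \<in> form_dom"
  shows "integrable lborel (\<lambda>x. snd F x * snd G x + (x\<^sup>2 + q x) * (fst F x * fst G x))"
  using form_dom_deriv_integrable[OF F] form_dom_x2_integrable[OF F] form_dom_potential_integrable[OF q F]
  unfolding distrib_right by auto

lemma form_pair_schroedinger:
  assumes q: "integrable lborel q" and q0: "\<And>x. 0 \<le> q x"
  shows "form_pair form_dom form_comb form_inner (form_energy q)"
proof
  fix F G and a b :: real assume F: "F \<in> form_dom" and G: "G \<in> form_dom"
  note D = form_domD[OF F] and E = form_domD[OF G]
  note [measurable] = D(1) E(1) form_dom_measurable[OF F] form_dom_measurable[OF G]
  have sq: "(a * y + b * z)\<^sup>2 = a\<^sup>2 * y\<^sup>2 + 2 * a * b * (y * z) + b\<^sup>2 * z\<^sup>2" for y z :: real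
    by (simp add: power2_eq_square algebra_simps)
  show "form_comb a F b G \<in> form_dom"
    unfolding form_comb_def form_dom_def mem_Collect_eq prod.case
  proof (intro conjI allI impI)
    show "(\<lambda>x. a * snd F x + b * snd G x) \<in> borel_measurable borel" by measurable
    show "integrable lborel (\<lambda>x. (a * snd F x + b * snd G x)\<^sup>2)"
      unfolding sq using D(2) E(2) form_dom_deriv_integrable[OF F G] by auto
    show "integrable lborel (\<lambda>x. (a * fst F x + b * fst G x)\<^sup>2)"
      unfolding sq using D(3) E(3) form_dom_inner_integrable[OF F G] by auto
    have "(\<lambda>x. x\<^sup>2 * (a * fst F x + b * fst G x)\<^sup>2) = (\<lambda>x. a\<^sup>2 * (x\<^sup>2 * (fst F x)\<^sup>2) + 2 * a * b * (x\<^sup>2 * (fst F x * fst G x)) + b\<^sup>2 * (x\<^sup>2 * (fst G x)\<^sup>2))"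
      unfolding sq by (simp add: algebra_simps)
    then show "integrable lborel (\<lambda>x. x\<^sup>2 * (a * fst F x + b * fst G x)\<^sup>2)"
      using D(4) E(4) form_dom_x2_integrable[OF F G] by simp
    fix s t :: real assume st: "s \<le> t"
    have "(LBINT x:{s..t}. a * snd F x + b * snd G x) = a * (LBINT x:{s..t}. snd F x) + b * (LBINT x:{s..t}. snd G x)"
      using L2_imp_set_integrable[OF D(1,2)] L2_imp_set_integrable[OF E(1,2)]
      by (simp add: set_integral_add)
    then show "a * fst F t + b * fst G t - (a * fst F s + b * fst G s) = (LBINT x:{s..t}. a * snd F x + b * snd G x)"
      unfolding D(5)[OF st, symmetric] E(5)[OF st, symmetric] by (simp add: algebra_simps)
  qed
  show "form_inner F G = form_inner G F" by (simp add: form_inner_def mult.commute)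
  show "form_energy q F G = form_energy q G F" by (simp add: form_energy_def mult.commute)
  show "0 \<le> form_inner F F" by (simp add: form_inner_def)
  show "0 \<le> form_energy q F F" unfolding form_energy_def
    by (intro integral_nonneg_AE AE_I2) (simp add: q0 add_nonneg_nonneg)
  fix H assume H: "H \<in> form_dom"
  show "form_inner (form_comb a F b G) H = a * form_inner F H + b * form_inner G H"
    using form_dom_inner_integrable[OF F H] form_dom_inner_integrable[OF G H]
    by (simp add: form_inner_def form_comb_def distrib_right mult.assoc)
  have "form_energy q (form_comb a F b G) H = (\<integral>x. a * (snd F x * snd H x + (x\<^sup>2 + q x) * (fst F x * fst H x)) + b * (snd G x * snd H x + (x\<^sup>2 + q x) * (fst G x * fst H x)) \<partial>lborel)"
    unfolding form_energy_def form_comb_def by (intro Bochner_Integration.integral_cong) (auto simp: algebra_simps)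
  also have "\<dots> = a * form_energy q F H + b * form_energy q G H"
    unfolding form_energy_def using form_energy_integrable[OF q F H] form_energy_integrable[OF q G H]
    by (subst Bochner_Integration.integral_add) simp_all
  finally show "form_energy q (form_comb a F b G) H = a * form_energy q F H + b * form_energy q G H" .
qed

section \<open>Hat functions as test elements\<close>

definition hat' :: "real \<Rightarrow> real \<Rightarrow> real \<Rightarrow> real \<Rightarrow> real" where
  "hat' a b c x = indicator {a..b} x / (b - a) - indicator {b..c} x / (c - b)"

lemma integral_indicator_Icc_Icc:
  fixes a b s t :: real
  assumes "a \<le> b" "s \<le> t"
  shows "(LBINT x:{s..t}. indicator {a..b} x :: real) = max 0 (b - s) - max 0 (b - t) - (max 0 (a - s) - max 0 (a - t))"
proof -
  have "(LBINT x:{s..t}. indicator {a..b} x :: real) = measure lborel ({s..t} \<inter> {a..b})"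
    unfolding set_lebesgue_integral_def by (simp flip: indicator_inter_arith)
  also have "{s..t} \<inter> {a..b} = {max s a..min t b}" by auto
  finally show ?thesis using assms by (auto simp: max_def min_def split: if_splits)
qed

lemma hat_in_form_dom:
  assumes abc: "a < b" "b < c"
  shows "(hat a b c, hat' a b c) \<in> form_dom"
  unfolding form_dom_def mem_Collect_eq prod.case
proof (intro conjI allI impI)
  show [measurable]: "hat' a b c \<in> borel_measurable borel" unfolding hat'_def by measurable
  have ind: "integrable lborel (indicat_real {s..t})" for s t :: real by (rule integrable_indicator_Icc)
  \<comment> \<open>The closed intervals share the point \<open>b\<close>, which leaves a cross term
    supported on that single point.\<close>
  have "(\<lambda>x. (hat' a b c x)\<^sup>2) = (\<lambda>x. indicator {a..b} x / (b - a)\<^sup>2 - 2 / ((b - a) * (c - b)) * indicator {b..b} x + indicator {b..c} x / (c - b)\<^sup>2)"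
    using abc by (auto simp: hat'_def fun_eq_iff power2_diff power_divide split: split_indicator)
  then show "integrable lborel (\<lambda>x. (hat' a b c x)\<^sup>2)" using ind by simp
  show "integrable lborel (\<lambda>x. (hat a b c x)\<^sup>2)"
    using integrable_continuous_times_hat[OF abc continuous_hat[of _ a b c]] by (simp add: power2_eq_square)
  have "integrable lborel (\<lambda>x. (x\<^sup>2 * hat a b c x) * hat a b c x)"
    by (intro integrable_continuous_times_hat abc continuous_intros)
  then show "integrable lborel (\<lambda>x. x\<^sup>2 * (hat a b c x)\<^sup>2)" by (simp add: power2_eq_square mult.assoc)
  fix s t :: real assume st: "s \<le> t"
  have i: "set_integrable lborel {s..t} (indicat_real {u..v})" for u v
    unfolding set_integrable_def by (simp add: integrable_indicator_Icc flip: indicator_inter_arith)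
  have "(LBINT x:{s..t}. hat' a b c x) = (LBINT x:{s..t}. indicator {a..b} x) / (b - a) - (LBINT x:{s..t}. indicator {b..c} x) / (c - b)"
    unfolding hat'_def using i by (subst set_integral_diff) auto
  also have "\<dots> = hat a b c t - hat a b c s"
    using abc st by (simp add: integral_indicator_Icc_Icc hat_def diff_divide_distrib ring_distribs)
  finally show "hat a b c t - hat a b c s = (LBINT x:{s..t}. hat' a b c x)" ..
qed

text \<open>Because \<open>hat'\<close> is piecewise constant, the derivative of \<open>F\<close>
  enters only through values of \<open>F\<close> at three points. This makes the weak equation
  stable under pointwise limits.\<close>

lemma form_energy_hat:
  assumes q: "integrable lborel q" and F: "F \<in> form_dom" and abc: "a < b" "b < c"
  shows "form_energy q F (hat a b c, hat' a b c) =
    (fst F b - fst F a) / (b - a) - (fst F c - fst F b) / (c - b) + (\<integral>x. (x\<^sup>2 + q x) * hat a b c x * fst F x \<partial>lborel)"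
proof -
  note H = hat_in_form_dom[OF abc]
  note D = form_domD[OF F]
  have i: "set_integrable lborel {s..t} (snd F)" for s t by (rule L2_imp_set_integrable[OF D(1,2)])
  have "(\<integral>x. snd F x * hat' a b c x \<partial>lborel) = (\<integral>x. (indicator {a..b} x * snd F x) / (b - a) - (indicator {b..c} x * snd F x) / (c - b) \<partial>lborel)"
    by (intro Bochner_Integration.integral_cong) (auto simp: hat'_def right_diff_distrib mult.commute)
  also have "\<dots> = (LBINT x:{a..b}. snd F x) / (b - a) - (LBINT x:{b..c}. snd F x) / (c - b)"
    using i unfolding set_integrable_def set_lebesgue_integral_def by simp
  also have "\<dots> = (fst F b - fst F a) / (b - a) - (fst F c - fst F b) / (c - b)"
    using D(5) abc by simp
  finally have 1: "(\<integral>x. snd F x * hat' a b c x \<partial>lborel) = (fst F b - fst F a) / (b - a) - (fst F c - fst F b) / (c - b)" .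
  have "integrable lborel (\<lambda>x. (x\<^sup>2 + q x) * (fst F x * hat a b c x))"
    using form_dom_x2_integrable[OF F H] form_dom_potential_integrable[OF q F H] by (simp add: distrib_right)
  then show ?thesis
    using form_dom_deriv_integrable[OF F H] 1 by (simp add: form_energy_def mult_ac)
qed

section \<open>Counting eigenvalues\<close>

text \<open>The largest of \<open>N + 1\<close> distinct indices is at least \<open>N\<close>;
  remove it and induct.\<close>

lemma mono_sum_initial_le:
  fixes lam :: "nat \<Rightarrow> real"
  assumes mono: "mono lam"
  shows "finite A \<Longrightarrow> card A = N \<Longrightarrow> (\<Sum>k<N. lam k) \<le> (\<Sum>j\<in>A. lam j)"
proof (induction N arbitrary: A)
  case 0
  then show ?case by simp
next
  case (Suc N)
  have ne: "A \<noteq> {}" using Suc.prems by auto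
  define M where "M = Max A"
  have M: "M \<in> A" using Suc.prems ne by (simp add: M_def)
  have "A \<subseteq> {..M}" using Suc.prems by (auto simp: M_def)
  then have "Suc N \<le> Suc M" using card_mono[of "{..M}" A] Suc.prems by simp
  then have "lam N \<le> lam M" using mono by (simp add: monoD)
  moreover have "(\<Sum>k<N. lam k) \<le> (\<Sum>j\<in>A - {M}. lam j)"
    using Suc.prems M by (intro Suc.IH) auto
  ultimately show ?case using sum.remove[OF Suc.prems(1) M, of lam] by simp
qed

text \<open>Independence of the whole family over \<open>L\<close> passes to the members over
  \<open>K\<close> by extending coefficients by 0; \<open>e\<close> renumbers \<open>K\<close> as an
  initial segment.\<close>

lemma has_indep_eigenfunctions_of_family:
  assumes sol: "\<And>k. k \<in> K \<Longrightarrow> L2_solution q mu (u k)" and K: "finite K" and sub: "K \<subseteq> L" "finite L"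
    and indep: "\<And>c. (\<forall>x. (\<Sum>k\<in>L. c k * u k x) = 0) \<Longrightarrow> \<forall>k\<in>L. c k = 0"
  shows "has_indep_eigenfunctions q mu (card K)"
proof -
  obtain e where e: "bij_betw e {..<card K} K"
    using ex_bij_betw_nat_finite[OF K] by (auto simp: atLeast0LessThan)
  have eK: "e i \<in> K" if "i < card K" for i using e that by (auto simp: bij_betw_def)
  have "c i = 0" if c: "\<forall>x. (\<Sum>i<card K. c i * u (e i) x) = 0" and i: "i < card K" for c :: "nat \<Rightarrow> real" and i
  proof -
    define d where "d k = (if k \<in> K then c (inv_into {..<card K} e k) else 0)" for k
    have de: "d (e j) = c j" if "j < card K" for j
      using that e eK[OF that] by (simp add: d_def bij_betw_def inv_into_f_f)
    have "(\<Sum>k\<in>L. d k * u k x) = 0" for x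
    proof -
      have "(\<Sum>k\<in>L. d k * u k x) = (\<Sum>k\<in>K. d k * u k x)"
        using sub by (intro sum.mono_neutral_right) (auto simp: d_def)
      also have "\<dots> = (\<Sum>i<card K. d (e i) * u (e i) x)"
        by (rule sum.reindex_bij_betw[OF e, symmetric])
      also have "\<dots> = 0" using c de by simp
      finally show ?thesis .
    qed
    then have "d (e i) = 0" using indep[of d] eK[OF i] sub by auto
    then show ?thesis using de[OF i] by simp
  qed
  then show ?thesis
    unfolding has_indep_eigenfunctions_def using sol eK
    by (intro exI[of _ "\<lambda>i. u (e i)"]) auto
qed

text \<open>For each parameter \<open>t\<close>, independence shows that \<open>lam\<close> takes
  the value \<open>t\<close> at least as often as \<open>mu\<close> does on \<open>{..n}\<close>.
  This gives injections fibre by fibre; as the fibres are disjoint they glue to one injection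
  \<open>g\<close> with \<open>lam (g k) = mu k\<close>.\<close>

lemma eigenvalue_sequence_sum_le:
  assumes lam: "eigenvalue_sequence q lam"
    and sol: "\<And>k. k \<le> n \<Longrightarrow> L2_solution q (mu k) (u k)"
    and indep: "\<And>c. (\<forall>x. (\<Sum>k\<le>n. c k * u k x) = 0) \<Longrightarrow> \<forall>k\<le>n. c k = 0"
  shows "(\<Sum>k\<le>n. lam k) \<le> (\<Sum>k\<le>n. mu k)"
proof -
  have mono: "mono lam" and fin: "\<And>t. finite {k. lam k = t}"
    and mult: "\<And>t N. N \<le> card {k. lam k = t} \<longleftrightarrow> has_indep_eigenfunctions q t N"
    using lam by (auto simp: eigenvalue_sequence_def)
  define K where "K t = {k. k \<le> n \<and> mu k = t}" for t
  have "\<exists>f. inj_on f (K t) \<and> f ` K t \<subseteq> {k. lam k = t}" for t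
  proof -
    have "has_indep_eigenfunctions q t (card (K t))"
      by (rule has_indep_eigenfunctions_of_family[where L = "{..n}" and u = u])
        (use sol indep in \<open>auto simp: K_def\<close>)
    then have "card (K t) \<le> card {k. lam k = t}" using mult by blast
    moreover have "finite (K t)" by (rule finite_subset[of _ "{..n}"]) (auto simp: K_def)
    ultimately obtain f where "f ` K t \<subseteq> {k. lam k = t}" "inj_on f (K t)"
      using card_le_inj[OF _ fin] by blast
    then show ?thesis by blast
  qed
  then obtain f where f: "\<And>t. inj_on (f t) (K t)" "\<And>t. f t ` K t \<subseteq> {k. lam k = t}" by metis
  define g where "g k = f (mu k) k" for k
  have lam_g: "lam (g k) = mu k" if "k \<le> n" for k
    using f(2)[of "mu k"] that by (auto simp: g_def K_def)
  have inj: "inj_on g {..n}"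
  proof (rule inj_onI)
    fix i j assume ij: "i \<in> {..n}" "j \<in> {..n}" "g i = g j"
    then have "mu i = mu j" using lam_g[of i] lam_g[of j] by auto
    then show "i = j" using ij f(1)[of "mu i"] by (auto simp: g_def K_def inj_on_def)
  qed
  have "(\<Sum>k<Suc n. lam k) \<le> (\<Sum>j\<in>g ` {..n}. lam j)"
    by (rule mono_sum_initial_le[OF mono]) (simp_all add: card_image[OF inj])
  also have "\<dots> = (\<Sum>k\<le>n. lam (g k))" by (simp add: sum.reindex[OF inj])
  also have "\<dots> = (\<Sum>k\<le>n. mu k)" using lam_g by simp
  finally show ?thesis by (simp add: lessThan_Suc_atMost)
qed

section \<open>Eigenpairs from near-minimal frames\<close>

lemma hermite_fun_continuous [continuous_intros]: "continuous_on S (hermite_fun k)"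
  using DERIV_isCont[OF hermite_fun_deriv] by (simp add: continuous_at_imp_continuous_on)

lemma hermite_fun'_continuous [continuous_intros]: "continuous_on S (hermite_fun' k)"
  unfolding hermite_fun'_def[abs_def] by (intro continuous_intros)

lemma hermite_in_form_dom: "(hermite_fun k, hermite_fun' k) \<in> form_dom"
  unfolding form_dom_def mem_Collect_eq prod.case
proof (intro conjI allI impI)
  show "hermite_fun' k \<in> borel_measurable borel"
    by (intro borel_measurable_continuous_onI continuous_intros)
  show "integrable lborel (\<lambda>x. (hermite_fun k x)\<^sup>2)"
    using integrable_hermite_prod[of k k] by (simp add: power2_eq_square)
  fix a b :: real assume "a \<le> b"
  moreover have "(hermite_fun k has_vector_derivative hermite_fun' k x) (at x within {a..b})" for x
    using has_field_derivative_at_within[OF hermite_fun_deriv]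
    by (simp add: has_real_derivative_iff_has_vector_derivative)
  ultimately show "hermite_fun k b - hermite_fun k a = (LBINT x:{a..b}. hermite_fun' k x)"
    unfolding set_lebesgue_integral_def
    using integral_FTC_atLeastAtMost[of a b "hermite_fun k" "hermite_fun' k"] hermite_fun'_continuous
    by simp
qed (rule hermite_energy)+

lemma form_energy_hermite:
  assumes q: "integrable lborel q"
  shows "form_energy q (hermite_fun k, hermite_fun' k) (hermite_fun k, hermite_fun' k)
    = lam0 k + (\<integral>x. q x * (hermite_fun k x)\<^sup>2 \<partial>lborel)"
    and "integrable lborel (\<lambda>x. q x * (hermite_fun k x)\<^sup>2)"
proof -
  note H = hermite_in_form_dom[of k]
  show i: "integrable lborel (\<lambda>x. q x * (hermite_fun k x)\<^sup>2)"
    using form_dom_potential_integrable[OF q H H] by (simp add: power2_eq_square)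
  have "form_energy q (hermite_fun k, hermite_fun' k) (hermite_fun k, hermite_fun' k)
    = (\<integral>x. (hermite_fun' k x)\<^sup>2 + x\<^sup>2 * (hermite_fun k x)\<^sup>2 + q x * (hermite_fun k x)\<^sup>2 \<partial>lborel)"
    unfolding form_energy_def by (intro Bochner_Integration.integral_cong) (auto simp: power2_eq_square algebra_simps)
  also have "\<dots> = (\<integral>x. (hermite_fun' k x)\<^sup>2 \<partial>lborel) + (\<integral>x. x\<^sup>2 * (hermite_fun k x)\<^sup>2 \<partial>lborel) + (\<integral>x. q x * (hermite_fun k x)\<^sup>2 \<partial>lborel)"
    using hermite_energy(1,2)[of k] i by simp
  finally show "form_energy q (hermite_fun k, hermite_fun' k) (hermite_fun k, hermite_fun' k)
    = lam0 k + (\<integral>x. q x * (hermite_fun k x)\<^sup>2 \<partial>lborel)"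
    unfolding hermite_energy(3) lam0_def .
qed

lemma form_energy_bounds:
  assumes q: "integrable lborel q" "\<And>x. 0 \<le> q x" and F: "F \<in> form_dom"
  shows "(\<integral>x. (snd F x)\<^sup>2 \<partial>lborel) \<le> form_energy q F F"
    and "(\<integral>x. x\<^sup>2 * (fst F x)\<^sup>2 \<partial>lborel) \<le> form_energy q F F"
  unfolding form_energy_def
  using form_energy_integrable[OF q(1) F F] form_domD(2,4)[OF F] q(2)
  by (auto intro!: integral_mono simp: distrib_right simp flip: power2_eq_square)

text \<open>A diagonal argument over the countably many pairs of an index and a rational point,
  after which the uniform Hoelder bound carries convergence from the rationals to every real
  point.\<close>

lemma holder_pointwise_subsequence:
  fixes f :: "nat \<Rightarrow> nat \<Rightarrow> real \<Rightarrow> real" and e :: "nat \<Rightarrow> nat \<Rightarrow> real"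
  assumes bound: "\<And>m k x. k \<le> n \<Longrightarrow> \<bar>f m k x\<bar> \<le> M"
    and holder: "\<And>m k x y. k \<le> n \<Longrightarrow> (f m k x - f m k y)\<^sup>2 \<le> \<bar>x - y\<bar> * W"
    and e: "\<And>m k. k \<le> n \<Longrightarrow> \<bar>e m k\<bar> \<le> W"
  obtains s u mu where "strict_mono (s :: nat \<Rightarrow> nat)"
    "\<And>k x. k \<le> n \<Longrightarrow> (\<lambda>m. f (s m) k x) \<longlonglongrightarrow> u k x"
    "\<And>k. k \<le> n \<Longrightarrow> (\<lambda>m. e (s m) k) \<longlonglongrightarrow> mu k"
proof -
  have "countable ({..n} \<times> \<rat> :: (nat \<times> real) set)" by (intro countable_SIGMA countable_rat) auto
  then obtain k1 :: "nat \<Rightarrow> nat" where k1: "strict_mono k1"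
    "\<And>p. p \<in> {..n} \<times> \<rat> \<Longrightarrow> \<exists>l. (\<lambda>m. (\<lambda>m (k, x). f m k x) (k1 m) p) \<longlonglongrightarrow> l"
    by (rule function_convergent_subsequence[where f = "\<lambda>m (k, x). f m k x" and M = M])
      (use bound in auto)
  obtain k2 :: "nat \<Rightarrow> nat" where k2: "strict_mono k2"
    "\<And>k. k \<in> {..n} \<Longrightarrow> \<exists>l. (\<lambda>m. (\<lambda>m k. e (k1 m) k) (k2 m) k) \<longlonglongrightarrow> l"
    by (rule function_convergent_subsequence[where f = "\<lambda>m k. e (k1 m) k" and M = W and S = "{..n}"])
      (use e in auto)
  define s where "s = k1 \<circ> k2"
  have s: "strict_mono s" unfolding s_def by (rule strict_mono_o[OF k1(1) k2(1)])
  have rat: "convergent (\<lambda>m. f (s m) k r)" if kr: "k \<le> n" "r \<in> \<rat>" for k r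
  proof -
    obtain l where "(\<lambda>m. f (k1 m) k r) \<longlonglongrightarrow> l" using k1(2)[of "(k, r)"] kr by auto
    from LIMSEQ_subseq_LIMSEQ[OF this k2(1)] show ?thesis by (auto simp: s_def o_def convergent_def)
  qed
  have conv: "convergent (\<lambda>m. f (s m) k x)" if k: "k \<le> n" for k x
    unfolding Cauchy_convergent_iff[symmetric]
  proof (rule CauchyI)
    fix \<epsilon> :: real assume \<epsilon>: "0 < \<epsilon>"
    \<comment> \<open>Chosen so that \<open>d * (\<bar>W\<bar> + 1)\<close> is the square of a third
      of \<open>\<epsilon>\<close>.\<close>
    define d where "d = (\<epsilon> / 3)\<^sup>2 / (\<bar>W\<bar> + 1)"
    have d: "d > 0" using \<epsilon> by (simp add: d_def add_nonneg_pos)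
    then obtain r where r: "r \<in> \<rat>" "x < r" "r < x + d" using Rats_dense_in_real[of x "x + d"] by auto
    have close: "\<bar>f m k x - f m k r\<bar> < \<epsilon> / 3" for m
    proof -
      have "(f m k x - f m k r)\<^sup>2 \<le> \<bar>x - r\<bar> * W" by (rule holder[OF k])
      also have "\<dots> \<le> \<bar>x - r\<bar> * (\<bar>W\<bar> + 1)" by (intro mult_left_mono) auto
      also have "\<dots> < d * (\<bar>W\<bar> + 1)" using r by (intro mult_strict_right_mono) auto
      also have "\<dots> = (\<epsilon> / 3)\<^sup>2" by (simp add: d_def)
      finally show ?thesis using \<epsilon> power2_less_imp_less[of "\<bar>f m k x - f m k r\<bar>" "\<epsilon> / 3"] by simp
    qed
    have "Cauchy (\<lambda>m. f (s m) k r)" using rat[OF k r(1)] by (simp add: Cauchy_convergent_iff)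
    then obtain N where N: "\<And>i j. i \<ge> N \<Longrightarrow> j \<ge> N \<Longrightarrow> norm (f (s i) k r - f (s j) k r) < \<epsilon> / 3"
      using CauchyD[of _ "\<epsilon> / 3"] \<epsilon> by (metis divide_pos_pos zero_less_numeral)
    have "norm (f (s i) k x - f (s j) k x) < \<epsilon>" if "i \<ge> N" "j \<ge> N" for i j
      using N[OF that] close[of "s i"] close[of "s j"] unfolding real_norm_def by linarith
    then show "\<exists>N. \<forall>i\<ge>N. \<forall>j\<ge>N. norm (f (s i) k x - f (s j) k x) < \<epsilon>" by blast
  qed
  have conv_e: "convergent (\<lambda>m. e (s m) k)" if "k \<le> n" for k
    using k2(2)[of k] that by (auto simp: s_def o_def convergent_def)
  show ?thesis
    by (rule that[of s "\<lambda>k x. lim (\<lambda>m. f (s m) k x)" "\<lambda>k. lim (\<lambda>m. e (s m) k)"])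
      (use s conv conv_e in \<open>simp_all add: convergent_LIMSEQ_iff\<close>)
qed

lemma bounded_convergence_weight:
  fixes v :: "real \<Rightarrow> real" and g :: "nat \<Rightarrow> real \<Rightarrow> real"
  assumes v: "integrable lborel v" and [measurable]: "\<And>m. g m \<in> borel_measurable borel" "u \<in> borel_measurable borel"
    and M: "\<And>m x. \<bar>g m x\<bar> \<le> M" and lim: "\<And>x. (\<lambda>m. g m x) \<longlonglongrightarrow> u x"
  shows "integrable lborel (\<lambda>x. v x * u x)"
    and "\<And>m. integrable lborel (\<lambda>x. v x * g m x)"
    and "(\<lambda>m. \<integral>x. v x * g m x \<partial>lborel) \<longlonglongrightarrow> (\<integral>x. v x * u x \<partial>lborel)"
proof -
  have [measurable]: "v \<in> borel_measurable borel" using borel_measurable_integrable[OF v] by simp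
  have w: "integrable lborel (\<lambda>x. \<bar>v x\<bar> * M)" using v by auto
  have le: "norm (v x * g m x) \<le> \<bar>v x\<bar> * M" for m x
    using M[of m x] by (simp add: abs_mult mult_left_mono)
  have l: "(\<lambda>m. v x * g m x) \<longlonglongrightarrow> v x * u x" for x by (intro tendsto_intros lim)
  have le': "norm (v x * u x) \<le> \<bar>v x\<bar> * M" for x
    by (rule LIMSEQ_le_const2[OF tendsto_norm[OF l]]) (use le in auto)
  show "integrable lborel (\<lambda>x. v x * u x)"
    by (rule Bochner_Integration.integrable_bound[OF w]) (use le' in \<open>auto intro!: AE_I2 intro: order_trans[OF _ abs_ge_self]\<close>)
  show "integrable lborel (\<lambda>x. v x * g m x)" for m
    by (rule Bochner_Integration.integrable_bound[OF w]) (use le in \<open>auto intro!: AE_I2 intro: order_trans[OF _ abs_ge_self]\<close>)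
  show "(\<lambda>m. \<integral>x. v x * g m x \<partial>lborel) \<longlonglongrightarrow> (\<integral>x. v x * u x \<partial>lborel)"
    by (rule integral_dominated_convergence[OF _ _ w]) (use le l in auto)
qed

text \<open>Energy bounds give uniform sup and Hoelder bounds, hence a pointwise convergent
  subsequence. The counting of eigenvalues asks of the limits only that they are independent
  solutions, so orthonormality itself is not carried over.\<close>

theorem eigenpairs_below_frame:
  assumes q: "integrable lborel q" "\<And>x. 0 \<le> q x"
    and \<Psi>: "form_pair.frame form_dom form_inner n \<Psi>"
    and w1: "\<And>k. k \<le> n \<Longrightarrow> w k \<ge> 1" and w_decr: "\<And>i j. i < j \<Longrightarrow> j \<le> n \<Longrightarrow> w j < w i"
  obtains mu u where "\<And>k. k \<le> n \<Longrightarrow> L2_solution q (mu k) (u k)"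
    and "\<And>k. k \<le> n \<Longrightarrow> 0 \<le> mu k"
    and "\<And>c. (\<forall>x. (\<Sum>k\<le>n. c k * u k x) = 0) \<Longrightarrow> \<forall>k\<le>n. c k = 0"
    and "(\<Sum>k\<le>n. w k * mu k) \<le> (\<Sum>k\<le>n. w k * form_energy q (\<Psi> k) (\<Psi> k))"
proof -
  interpret form_pair form_dom form_comb form_inner "form_energy q" by (rule form_pair_schroedinger[OF q])
  obtain F where F: "\<And>m. frame n (F m)"
    and F_energy: "\<And>m. energy w n (F m) \<le> energy w n \<Psi> + 1 / real (Suc m)"
    and F_eq: "\<And>g k. g \<in> form_dom \<Longrightarrow> k \<le> n \<Longrightarrow>
      (\<lambda>m. form_energy q (F m k) g - form_energy q (F m k) (F m k) * form_inner (F m k) g) \<longlonglongrightarrow> 0"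
    by (rule near_minimal_frames[where w = w, OF \<Psi>]) (assumption | rule w1 w_decr | blast)+
  define W where "W = energy w n \<Psi> + 1"
  define e where "e m k = form_energy q (F m k) (F m k)" for m k
  define f where "f m k = fst (F m k)" for m k
  have inD: "F m k \<in> form_dom" if "k \<le> n" for m k using frame_in[OF F that] .
  have e0: "0 \<le> e m k" if "k \<le> n" for m k unfolding e_def by (rule Q_nonneg[OF inD[OF that]])
  have eW: "e m k \<le> W" if k: "k \<le> n" for m k
  proof -
    have "e m k \<le> w k * e m k" using mult_right_mono[OF w1[OF k] e0[OF k, of m]] by simp
    also have "\<dots> \<le> energy w n (F m)" unfolding energy_def e_def[symmetric]
      by (rule member_le_sum) (use k order_trans[OF zero_le_one w1] e0 in auto)
    also have "\<dots> \<le> energy w n \<Psi> + 1 / real (Suc m)" by (rule F_energy)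
    also have "\<dots> \<le> W" by (simp add: W_def)
    finally show ?thesis .
  qed
  have W0: "0 \<le> W" using e0[of 0 0] eW[of 0 0] by simp
  have norm1: "(\<integral>x. f m i x * f m j x \<partial>lborel) = (if i = j then 1 else 0)" if "i \<le> n" "j \<le> n" for m i j
    using frame_B[OF F that, of m] by (simp add: form_inner_def f_def)
  have d2: "(\<integral>x. (snd (F m k) x)\<^sup>2 \<partial>lborel) \<le> W" and x2: "(\<integral>x. x\<^sup>2 * (f m k x)\<^sup>2 \<partial>lborel) \<le> W" if k: "k \<le> n" for m k
    using form_energy_bounds[OF q inD[OF k, of m]] eW[OF k, of m] by (simp_all add: f_def e_def)
  have holder: "(f m k x - f m k y)\<^sup>2 \<le> \<bar>x - y\<bar> * W" if k: "k \<le> n" for m k x y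
  proof -
    have "(f m k x - f m k y)\<^sup>2 \<le> \<bar>x - y\<bar> * (\<integral>x. (snd (F m k) x)\<^sup>2 \<partial>lborel)"
      unfolding f_def by (rule form_dom_holder_abs[OF inD[OF k]])
    also have "\<dots> \<le> \<bar>x - y\<bar> * W" by (intro mult_left_mono d2 k) simp
    finally show ?thesis .
  qed
  define M where "M = sqrt (2 + 2 * W)"
  have M0: "M \<ge> 0" using W0 by (simp add: M_def)
  have bound: "\<bar>f m k x\<bar> \<le> M" if k: "k \<le> n" for m k x
  proof -
    have "(f m k x)\<^sup>2 \<le> 2 * 1 + 2 * W"
      using form_dom_bounded[OF inD[OF k], of m x] d2[OF k, of m] norm1[OF k k, of m]
      by (simp add: f_def power2_eq_square)
    then show ?thesis unfolding M_def by (metis real_sqrt_abs real_sqrt_le_mono mult.right_neutral)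
  qed
  have eW': "\<bar>e m k\<bar> \<le> W" if "k \<le> n" for m k using e0[OF that, of m] eW[OF that, of m] by simp
  obtain s u mu where s: "strict_mono s"
    and u: "\<And>k x. k \<le> n \<Longrightarrow> (\<lambda>m. f (s m) k x) \<longlonglongrightarrow> u k x"
    and mu: "\<And>k. k \<le> n \<Longrightarrow> (\<lambda>m. e (s m) k) \<longlonglongrightarrow> mu k"
    by (rule holder_pointwise_subsequence[where f = f and e = e and n = n and M = M and W = W])
      (assumption | rule bound holder eW' | blast)+
  have fm: "f m k \<in> borel_measurable borel" if "k \<le> n" for m k
    unfolding f_def by (rule form_dom_measurable[OF inD[OF that]])
  have u_cont: "continuous_on UNIV (u k)" if k: "k \<le> n" for k
  proof (rule holder_continuous)
    fix x y
    have "(\<lambda>m. (f (s m) k x - f (s m) k y)\<^sup>2) \<longlonglongrightarrow> (u k x - u k y)\<^sup>2" by (intro tendsto_intros u k)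
    then show "(u k x - u k y)\<^sup>2 \<le> \<bar>x - y\<bar> * W" by (rule LIMSEQ_le_const2) (use holder[OF k] in auto)
  qed
  have um: "u k \<in> borel_measurable borel" if "k \<le> n" for k
    by (intro borel_measurable_continuous_onI u_cont that)
  \<comment> \<open>Fatou's lemma applied to the unit norms of the frame members.\<close>
  have u_L2: "integrable lborel (\<lambda>x. (u k x)\<^sup>2)" if k: "k \<le> n" for k
  proof (rule integrableI_bounded)
    show "(\<lambda>x. (u k x)\<^sup>2) \<in> borel_measurable lborel" using um[OF k] by measurable
    have "(\<integral>\<^sup>+x. ennreal (norm ((u k x)\<^sup>2)) \<partial>lborel) = (\<integral>\<^sup>+x. liminf (\<lambda>m. ennreal ((f (s m) k x)\<^sup>2)) \<partial>lborel)"
    proof (intro nn_integral_cong)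
      fix x
      have "(\<lambda>m. ennreal ((f (s m) k x)\<^sup>2)) \<longlonglongrightarrow> ennreal ((u k x)\<^sup>2)" by (intro tendsto_intros u k)
      then show "ennreal (norm ((u k x)\<^sup>2)) = liminf (\<lambda>m. ennreal ((f (s m) k x)\<^sup>2))"
        unfolding real_norm_def abs_power2 by (rule lim_imp_Liminf[OF sequentially_bot, symmetric])
    qed
    also have "\<dots> \<le> liminf (\<lambda>m. \<integral>\<^sup>+x. ennreal ((f (s m) k x)\<^sup>2) \<partial>lborel)"
      by (intro nn_integral_liminf) (simp add: fm[OF k] borel_measurable_power)
    also have "(\<lambda>m. \<integral>\<^sup>+x. ennreal ((f (s m) k x)\<^sup>2) \<partial>lborel) = (\<lambda>m. 1)"
    proof
      fix m
      have "integrable lborel (\<lambda>x. (f (s m) k x)\<^sup>2)" unfolding f_def by (rule form_domD(3)[OF inD[OF k]])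
      then have "(\<integral>\<^sup>+x. ennreal ((f (s m) k x)\<^sup>2) \<partial>lborel) = ennreal (\<integral>x. (f (s m) k x)\<^sup>2 \<partial>lborel)"
        by (intro nn_integral_eq_integral) auto
      then show "(\<integral>\<^sup>+x. ennreal ((f (s m) k x)\<^sup>2) \<partial>lborel) = 1" using norm1[OF k k, of "s m"] by (simp add: power2_eq_square)
    qed
    also have "liminf (\<lambda>m::nat. 1 :: ennreal) < \<infinity>" by (simp add: Liminf_const)
    finally show "(\<integral>\<^sup>+x. ennreal (norm ((u k x)\<^sup>2)) \<partial>lborel) < \<infinity>" .
  qed

  have sol: "L2_solution q (mu k) (u k)" if k: "k \<le> n" for k
  proof (rule L2_solution_weakI[OF q(1) u_cont[OF k] u_L2[OF k]])
    fix a b c :: real assume abc: "a < b" "b < c"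
    define H where "H = (hat a b c, hat' a b c)"
    have H: "H \<in> form_dom" unfolding H_def by (rule hat_in_form_dom[OF abc])
    have v1: "integrable lborel (hat a b c)"
      using integrable_continuous_times_hat[OF abc continuous_on_const[of _ 1]] by simp
    have v2: "integrable lborel (\<lambda>x. (x\<^sup>2 + q x) * hat a b c x)"
    proof -
      obtain K where K: "\<And>x. \<bar>hat a b c x\<bar> \<le> K" using hat_bounded[OF abc] by blast
      have [measurable]: "q \<in> borel_measurable borel" using borel_measurable_integrable[OF q(1)] by simp
      have "integrable lborel (\<lambda>x. q x * hat a b c x)"
        by (rule Bochner_Integration.integrable_bound[OF integrable_mult_left[OF q(1), of K]])
          (auto simp: abs_mult intro!: mult_left_mono order_trans[OF K])
      moreover have "integrable lborel (\<lambda>x. x\<^sup>2 * hat a b c x)"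
        by (intro integrable_continuous_times_hat abc continuous_intros)
      ultimately show ?thesis unfolding distrib_right by simp
    qed
    have g: "\<And>m. f (s m) k \<in> borel_measurable borel" "u k \<in> borel_measurable borel" using fm um k by auto
    note c1 = bounded_convergence_weight[OF v1 g bound[OF k] u[OF k]]
    note c2 = bounded_convergence_weight[OF v2 g bound[OF k] u[OF k]]
    have resid: "(\<lambda>m. form_energy q (F (s m) k) H - e (s m) k * form_inner (F (s m) k) H) \<longlonglongrightarrow> 0"
      using LIMSEQ_subseq_LIMSEQ[OF F_eq[OF H k] s] by (simp add: o_def e_def)
    \<comment> \<open>Only point values and integrals against fixed integrable weights remain, so
      pointwise convergence with a uniform bound suffices for the limit.\<close>
    have resid_eq: "form_energy q (F (s m) k) H - e (s m) k * form_inner (F (s m) k) H =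
       ((f (s m) k b - f (s m) k a) / (b - a) - (f (s m) k c - f (s m) k b) / (c - b)
        + (\<integral>x. (x\<^sup>2 + q x) * hat a b c x * f (s m) k x \<partial>lborel)) - e (s m) k * (\<integral>x. hat a b c x * f (s m) k x \<partial>lborel)" for m
      unfolding H_def form_energy_hat[OF q(1) inD[OF k] abc] by (simp add: f_def form_inner_def mult.commute)
    have "(\<lambda>m. ((f (s m) k b - f (s m) k a) / (b - a) - (f (s m) k c - f (s m) k b) / (c - b)
        + (\<integral>x. (x\<^sup>2 + q x) * hat a b c x * f (s m) k x \<partial>lborel)) - e (s m) k * (\<integral>x. hat a b c x * f (s m) k x \<partial>lborel))
      \<longlonglongrightarrow> ((u k b - u k a) / (b - a) - (u k c - u k b) / (c - b)
        + (\<integral>x. (x\<^sup>2 + q x) * hat a b c x * u k x \<partial>lborel)) - mu k * (\<integral>x. hat a b c x * u k x \<partial>lborel)"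
      by (intro tendsto_add tendsto_diff tendsto_divide tendsto_mult tendsto_const u[OF k] mu[OF k] c1(3) c2(3)) (use abc in auto)
    from LIMSEQ_unique[OF this resid[unfolded resid_eq]] have "((u k b - u k a) / (b - a) - (u k c - u k b) / (c - b)
        + (\<integral>x. (x\<^sup>2 + q x) * hat a b c x * u k x \<partial>lborel)) - mu k * (\<integral>x. hat a b c x * u k x \<partial>lborel) = 0" .
    moreover have "(\<integral>x. (x\<^sup>2 + q x - mu k) * u k x * hat a b c x \<partial>lborel)
       = (\<integral>x. (x\<^sup>2 + q x) * hat a b c x * u k x - mu k * (hat a b c x * u k x) \<partial>lborel)"
      by (intro Bochner_Integration.integral_cong) (auto simp: algebra_simps)
    moreover have "\<dots> = (\<integral>x. (x\<^sup>2 + q x) * hat a b c x * u k x \<partial>lborel) - mu k * (\<integral>x. hat a b c x * u k x \<partial>lborel)"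
      using c1(1) c2(1) by simp
    ultimately show "(u k b - u k a) / (b - a) - (u k c - u k b) / (c - b)
      + (\<integral>x. (x\<^sup>2 + q x - mu k) * u k x * hat a b c x \<partial>lborel) = 0" by simp
  qed

  \<comment> \<open>Suppose a combination of the limits vanishes. The same combinations of frame
    members have constant squared norm \<open>N\<close>. Inside \<open>{-R..R}\<close> their mass
    tends to 0 by bounded convergence, and outside it is at most \<open>K / R\<^sup>2\<close>;
    letting \<open>R\<close> grow gives \<open>N \<le> 0\<close>.\<close>
  have indep: "\<forall>k\<le>n. c k = 0" if c: "\<forall>x. (\<Sum>k\<le>n. c k * u k x) = 0" for c :: "nat \<Rightarrow> real"
  proof -
    define g where "g m x = (\<Sum>k\<le>n. c k * f (s m) k x)\<^sup>2" for m x
    define N where "N = (\<Sum>k\<le>n. (c k)\<^sup>2)"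
    \<comment> \<open>Bounds the integral of \<open>x\<^sup>2 * g m x\<close>:
      \<open>real n + 1\<close> stems from Cauchy-Schwarz over the summands, \<open>W\<close> from
      the energy of each frame member.\<close>
    define K where "K = (\<Sum>k\<le>n. (c k)\<^sup>2 * W) * (real n + 1)"
    have gm [measurable]: "g m \<in> borel_measurable borel" for m
      unfolding g_def by (intro borel_measurable_power borel_measurable_sum borel_measurable_times) (auto intro: fm)
    have g_int: "integrable lborel (g m)" and g_N: "(\<integral>x. g m x \<partial>lborel) = N" for m
    proof -
      have eq: "g m x = (\<Sum>i\<le>n. \<Sum>j\<le>n. c i * c j * (f (s m) i x * f (s m) j x))" for x
        by (simp add: g_def power2_eq_square sum_product mult_ac)
      have ij: "integrable lborel (\<lambda>x. f (s m) i x * f (s m) j x)" if "i \<le> n" "j \<le> n" for i j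
        unfolding f_def by (intro form_dom_inner_integrable inD that)
      show "integrable lborel (g m)" unfolding eq
        by (intro Bochner_Integration.integrable_sum integrable_mult_right ij) auto
      have "(\<integral>x. g m x \<partial>lborel) = (\<Sum>i\<le>n. \<integral>x. (\<Sum>j\<le>n. c i * c j * (f (s m) i x * f (s m) j x)) \<partial>lborel)"
        unfolding eq
        by (intro Bochner_Integration.integral_sum Bochner_Integration.integrable_sum integrable_mult_right ij) auto
      also have "\<dots> = (\<Sum>i\<le>n. \<Sum>j\<le>n. c i * c j * (\<integral>x. f (s m) i x * f (s m) j x \<partial>lborel))"
        using ij by (intro sum.cong refl) (simp add: Bochner_Integration.integral_sum)
      also have "\<dots> = (\<Sum>i\<le>n. \<Sum>j\<le>n. if i = j then c i * c j else 0)"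
        by (intro sum.cong refl) (simp add: norm1)
      also have "\<dots> = N" by (simp add: N_def power2_eq_square)
      finally show "(\<integral>x. g m x \<partial>lborel) = N" .
    qed
    have x2f: "integrable lborel (\<lambda>x. x\<^sup>2 * (f m k x)\<^sup>2)" if "k \<le> n" for m k
      unfolding f_def by (rule form_domD(4)[OF inD[OF that]])
    have x2g: "x\<^sup>2 * g m x \<le> (\<Sum>k\<le>n. (c k)\<^sup>2 * (x\<^sup>2 * (f (s m) k x)\<^sup>2)) * (real n + 1)" for m x
    proof -
      have "g m x \<le> (\<Sum>k\<le>n. (c k * f (s m) k x)\<^sup>2) * real (card {..n})"
        unfolding g_def by (rule sum_squared_le_sum_of_squares)
      then have "x\<^sup>2 * g m x \<le> x\<^sup>2 * ((\<Sum>k\<le>n. (c k * f (s m) k x)\<^sup>2) * real (card {..n}))"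
        by (intro mult_left_mono) auto
      also have "\<dots> = (\<Sum>k\<le>n. (c k)\<^sup>2 * (x\<^sup>2 * (f (s m) k x)\<^sup>2)) * (real n + 1)"
        by (simp add: sum_distrib_left sum_distrib_right power_mult_distrib mult_ac add_ac)
      finally show ?thesis .
    qed
    have x2g_int: "integrable lborel (\<lambda>x. (\<Sum>k\<le>n. (c k)\<^sup>2 * (x\<^sup>2 * (f (s m) k x)\<^sup>2)) * (real n + 1))" for m
      by (intro integrable_mult_left Bochner_Integration.integrable_sum integrable_mult_right x2f) auto
    have x2g_K: "(\<integral>x. (\<Sum>k\<le>n. (c k)\<^sup>2 * (x\<^sup>2 * (f (s m) k x)\<^sup>2)) * (real n + 1) \<partial>lborel) \<le> K" for m
    proof -
      have "(\<integral>x. (\<Sum>k\<le>n. (c k)\<^sup>2 * (x\<^sup>2 * (f (s m) k x)\<^sup>2)) * (real n + 1) \<partial>lborel)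
         = (\<Sum>k\<le>n. (c k)\<^sup>2 * (\<integral>x. x\<^sup>2 * (f (s m) k x)\<^sup>2 \<partial>lborel)) * (real n + 1)"
        using x2f by (simp add: Bochner_Integration.integral_sum)
      also have "\<dots> \<le> K" unfolding K_def
        by (intro mult_right_mono sum_mono mult_left_mono x2) auto
      finally show ?thesis .
    qed
    have g_bound: "\<bar>g m x\<bar> \<le> (\<Sum>k\<le>n. \<bar>c k\<bar> * M)\<^sup>2" for m x
    proof -
      have "\<bar>\<Sum>k\<le>n. c k * f (s m) k x\<bar> \<le> (\<Sum>k\<le>n. \<bar>c k\<bar> * M)"
        by (rule order_trans[OF sum_abs], rule sum_mono) (auto simp: abs_mult intro!: mult_left_mono bound)
      then have "\<bar>\<Sum>k\<le>n. c k * f (s m) k x\<bar>\<^sup>2 \<le> (\<Sum>k\<le>n. \<bar>c k\<bar> * M)\<^sup>2" by (intro power_mono) auto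
      then show ?thesis by (simp add: g_def)
    qed
    have g_lim: "(\<lambda>m. g m x) \<longlonglongrightarrow> 0" for x
    proof -
      have "(\<lambda>m. g m x) \<longlonglongrightarrow> (\<Sum>k\<le>n. c k * u k x)\<^sup>2"
        unfolding g_def by (intro tendsto_intros u) auto
      then show ?thesis using c by simp
    qed
    have NR: "N \<le> K / R\<^sup>2" if R: "R > 0" for R
    proof -
      have ind: "integrable lborel (indicat_real {-R..R})" by (rule integrable_indicator_Icc)
      note bc = bounded_convergence_weight[OF ind gm borel_measurable_const g_bound g_lim]
      have "N \<le> (\<integral>x. indicator {-R..R} x * g m x \<partial>lborel) + K / R\<^sup>2" for m
      proof -
        define G where "G x = (\<Sum>k\<le>n. (c k)\<^sup>2 * (x\<^sup>2 * (f (s m) k x)\<^sup>2)) * (real n + 1)" for x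
        have Gi: "integrable lborel G" and GK: "(\<integral>x. G x \<partial>lborel) \<le> K"
          using x2g_int[of m] x2g_K[of m] by (simp_all add: G_def[abs_def])
        have pw: "g m x \<le> indicator {-R..R} x * g m x + G x / R\<^sup>2" for x
        proof -
          have xg: "x\<^sup>2 * g m x \<le> G x" using x2g[of x m] by (simp add: G_def)
          have g0: "0 \<le> g m x" by (simp add: g_def)
          show ?thesis
          proof (cases "x \<in> {-R..R}")
            case True
            have "0 \<le> G x" using xg g0 by (meson order_trans mult_nonneg_nonneg zero_le_power2)
            then show ?thesis using True by simp
          next
            case False
            then have "R\<^sup>2 \<le> x\<^sup>2" using R by (auto simp flip: abs_le_square_iff)
            then have "R\<^sup>2 * g m x \<le> G x" using xg g0 mult_right_mono[of "R\<^sup>2" "x\<^sup>2" "g m x"] by linarith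
            then show ?thesis using False R by (simp add: pos_le_divide_eq mult.commute)
          qed
        qed
        have "N = (\<integral>x. g m x \<partial>lborel)" by (simp add: g_N)
        also have "\<dots> \<le> (\<integral>x. indicator {-R..R} x * g m x + G x / R\<^sup>2 \<partial>lborel)"
          by (rule integral_mono[OF g_int _ pw]) (use bc(2)[of m] Gi in auto)
        also have "\<dots> = (\<integral>x. indicator {-R..R} x * g m x \<partial>lborel) + (\<integral>x. G x \<partial>lborel) / R\<^sup>2"
          using bc(2)[of m] Gi by simp
        also have "\<dots> \<le> (\<integral>x. indicator {-R..R} x * g m x \<partial>lborel) + K / R\<^sup>2"
          by (intro add_left_mono divide_right_mono GK) simp
        finally show ?thesis .
      qed
      moreover have "(\<lambda>m. (\<integral>x. indicator {-R..R} x * g m x \<partial>lborel) + K / R\<^sup>2) \<longlonglongrightarrow> 0 + K / R\<^sup>2"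
        using bc(3) by (intro tendsto_add tendsto_const) simp
      ultimately show ?thesis using LIMSEQ_le_const by fastforce
    qed
    have "(\<lambda>i. K / (real (Suc i))\<^sup>2) \<longlonglongrightarrow> 0" by real_asymp
    then have "N \<le> 0" by (rule LIMSEQ_le_const) (use NR in \<open>auto simp del: of_nat_Suc\<close>)
    moreover have "N \<ge> (c k)\<^sup>2" if "k \<le> n" for k
      unfolding N_def by (rule member_le_sum) (use that in auto)
    ultimately show ?thesis by (metis order_trans power2_less_eq_zero_iff)
  qed

  have mu0: "0 \<le> mu k" if k: "k \<le> n" for k
    by (rule LIMSEQ_le_const[OF mu[OF k]]) (use e0[OF k] in auto)
  have "(\<lambda>m. \<Sum>k\<le>n. w k * e (s m) k) \<longlonglongrightarrow> (\<Sum>k\<le>n. w k * mu k)" by (intro tendsto_intros mu) auto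
  moreover have "(\<lambda>m. energy w n \<Psi> + 1 / real (Suc (s m))) \<longlonglongrightarrow> energy w n \<Psi> + 0"
    by (intro tendsto_intros LIMSEQ_subseq_LIMSEQ[OF LIMSEQ_inverse_real_of_nat[unfolded inverse_eq_divide] s, unfolded o_def])
  ultimately have "(\<Sum>k\<le>n. w k * mu k) \<le> energy w n \<Psi> + 0"
    by (rule LIMSEQ_le) (use F_energy in \<open>auto simp: energy_def e_def\<close>)
  then have le: "(\<Sum>k\<le>n. w k * mu k) \<le> (\<Sum>k\<le>n. w k * form_energy q (\<Psi> k) (\<Psi> k))"
    by (simp add: energy_def)
  show ?thesis by (rule that[of mu u]) (use sol mu0 indep le in auto)
qed

text \<open>The weights \<open>1 + \<delta> * (n - k)\<close> are strictly decreasing and at least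
  1. Because the parameters \<open>mu k\<close> are nonnegative, dropping the weights on their side
  preserves the inequality; on the Hermite side the weights cost
  \<open>\<delta> * Y\<close>.\<close>

theorem eigenvalue_sum_le_hermite_energy:
  assumes q: "integrable lborel q" "\<And>x. 0 \<le> q x" and lam: "eigenvalue_sequence q lam"
  shows "(\<Sum>k\<le>n. lam k) \<le> (\<Sum>k\<le>n. lam0 k + (\<integral>x. q x * (hermite_fun k x)\<^sup>2 \<partial>lborel))"
proof -
  interpret form_pair form_dom form_comb form_inner "form_energy q" by (rule form_pair_schroedinger[OF q])
  define \<Psi> where "\<Psi> k = (hermite_fun k, hermite_fun' k)" for k
  define E where "E k = form_energy q (\<Psi> k) (\<Psi> k)" for k
  have \<Psi>: "frame n \<Psi>"
    unfolding frame_def \<Psi>_def form_inner_def by (simp add: hermite_in_form_dom hermite_orthonormal)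
  have E0: "0 \<le> E k" for k unfolding E_def \<Psi>_def by (intro Q_nonneg hermite_in_form_dom)
  define Y where "Y = (\<Sum>k\<le>n. (real n - real k) * E k)"
  have Y0: "0 \<le> Y" unfolding Y_def by (intro sum_nonneg mult_nonneg_nonneg E0) auto
  have le: "(\<Sum>k\<le>n. lam k) \<le> (\<Sum>k\<le>n. E k) + \<delta> * Y" if \<delta>: "\<delta> > 0" for \<delta>
  proof -
    define w where "w k = 1 + \<delta> * (real n - real k)" for k
    have w1: "w k \<ge> 1" if "k \<le> n" for k using that \<delta> by (simp add: w_def)
    have w_decr: "w j < w i" if "i < j" "j \<le> n" for i j using that \<delta> by (simp add: w_def)
    obtain mu u where mu: "\<And>k. k \<le> n \<Longrightarrow> L2_solution q (mu k) (u k)" "\<And>k. k \<le> n \<Longrightarrow> 0 \<le> mu k"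
      "\<And>c. (\<forall>x. (\<Sum>k\<le>n. c k * u k x) = 0) \<Longrightarrow> \<forall>k\<le>n. c k = 0"
      "(\<Sum>k\<le>n. w k * mu k) \<le> (\<Sum>k\<le>n. w k * form_energy q (\<Psi> k) (\<Psi> k))"
      by (rule eigenpairs_below_frame[where w = w, OF q \<Psi>]) (assumption | rule w1 w_decr | blast)+
    have "(\<Sum>k\<le>n. lam k) \<le> (\<Sum>k\<le>n. mu k)" by (rule eigenvalue_sequence_sum_le[OF lam mu(1,3)])
    also have "\<dots> \<le> (\<Sum>k\<le>n. w k * mu k)"
      by (rule sum_mono) (use mult_right_mono[OF w1 mu(2)] in auto)
    also have "\<dots> \<le> (\<Sum>k\<le>n. w k * E k)" using mu(4) by (simp add: E_def)
    also have "\<dots> = (\<Sum>k\<le>n. E k) + \<delta> * Y"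
      by (simp add: w_def Y_def distrib_right sum.distrib sum_distrib_left mult.assoc)
    finally show ?thesis .
  qed
  have "(\<Sum>k\<le>n. lam k) \<le> (\<Sum>k\<le>n. E k)"
  proof (rule field_le_epsilon)
    fix \<epsilon> :: real assume \<epsilon>: "0 < \<epsilon>"
    \<comment> \<open>The choice of \<open>\<delta>\<close> for a given \<open>\<epsilon>\<close>;
      \<open>Y + 1\<close> is positive even when \<open>Y = 0\<close>.\<close>
    have "\<epsilon> / (Y + 1) * Y \<le> \<epsilon>" using \<epsilon> Y0 by (simp add: field_simps)
    then show "(\<Sum>k\<le>n. lam k) \<le> (\<Sum>k\<le>n. E k) + \<epsilon>" using le[of "\<epsilon> / (Y + 1)"] \<epsilon> Y0 by simp
  qed
  then show ?thesis by (simp add: E_def \<Psi>_def form_energy_hermite[OF q(1)])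
qed

lemma hermite_potential_sum_le:
  assumes q: "integrable lborel q" "\<And>x. 0 \<le> q x"
  shows "(\<Sum>k\<le>n. \<integral>x. q x * (hermite_fun k x)\<^sup>2 \<partial>lborel) \<le> density_bound n / pi * integral\<^sup>L lborel q"
proof -
  note i = form_energy_hermite(2)[OF q(1)]
  have "(\<Sum>k\<le>n. \<integral>x. q x * (hermite_fun k x)\<^sup>2 \<partial>lborel) = (\<integral>x. (\<Sum>k\<le>n. q x * (hermite_fun k x)\<^sup>2) \<partial>lborel)"
    using i by (simp add: Bochner_Integration.integral_sum)
  also have "\<dots> \<le> (\<integral>x. q x * (density_bound n / pi) \<partial>lborel)"
  proof (rule integral_mono)
    show "integrable lborel (\<lambda>x. \<Sum>k\<le>n. q x * (hermite_fun k x)\<^sup>2)" using i by simp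
    show "integrable lborel (\<lambda>x. q x * (density_bound n / pi))" using q(1) by simp
    show "(\<Sum>k\<le>n. q x * (hermite_fun k x)\<^sup>2) \<le> q x * (density_bound n / pi)" for x
      using mult_left_mono[OF hermite_density_le[of n x] q(2)[of x]]
      by (simp add: hermite_density_def sum_distrib_left)
  qed
  finally show ?thesis by (simp add: mult.commute)
qed

theorem theorem3p1:
  fixes q :: "real \<Rightarrow> real" and lam :: "nat \<Rightarrow> real"
  assumes q_nonneg: "\<And>x. q x \<ge> 0"
    and q_L1: "integrable lborel q"
    and lam: "eigenvalue_sequence q lam"
  shows "(\<forall>n. (\<Sum>k\<le>n. lam k - lam0 k - 1 / (pi * sqrt (lam0 k)) * integral\<^sup>L lborel q)
               \<le> chi n / pi * integral\<^sup>L lborel q) \<and>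
         ((\<lambda>n. chi n - (- Z0 (1/2))) \<in> O(\<lambda>n. 1 / sqrt (real n)))"
proof (intro conjI allI)
  fix n
  define I where "I = integral\<^sup>L lborel q"
  have "(\<Sum>k\<le>n. lam k) \<le> (\<Sum>k\<le>n. lam0 k) + density_bound n / pi * I"
    using eigenvalue_sum_le_hermite_energy[OF q_L1 q_nonneg lam, of n] hermite_potential_sum_le[OF q_L1 q_nonneg, of n]
    by (simp add: sum.distrib I_def)
  moreover have "(\<Sum>k\<le>n. lam k - lam0 k - 1 / (pi * sqrt (lam0 k)) * I)
      = (\<Sum>k\<le>n. lam k) - (\<Sum>k\<le>n. lam0 k) - (\<Sum>k\<le>n. 1 / sqrt (lam0 k)) / pi * I"
    by (simp add: sum_subtractf sum_divide_distrib sum_distrib_left mult.commute)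
  \<comment> \<open>The inverse square roots enter both sides of the claim with the same factor and
    cancel, leaving the bound by \<open>density_bound\<close>.\<close>
  moreover have "chi n / pi * I = density_bound n / pi * I - (\<Sum>k\<le>n. 1 / sqrt (lam0 k)) / pi * I"
    unfolding chi_eq by (simp add: diff_divide_distrib left_diff_distrib)
  ultimately show "(\<Sum>k\<le>n. lam k - lam0 k - 1 / (pi * sqrt (lam0 k)) * integral\<^sup>L lborel q)
      \<le> chi n / pi * integral\<^sup>L lborel q"
    unfolding I_def by linarith
qed (rule chi_asymp)

end
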